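(* Let $\boldsymbol{\alpha}_\infty=\boldsymbol{\alpha}_\infty(t)$, $0\le t\le T$, be a streamline of $u_\infty$, i.e. a continuous curve with $$\frac{d\boldsymbol{\alpha}_\infty(t)}{dt}=\nabla u_\infty(\boldsymbol{\alpha}_\infty(t)),\qquad 0\le t<T,$$ $\boldsymbol{\alpha}_\infty(0)\in\partial\Omega$ and $\boldsymbol{\alpha}_\infty(T)\in\partial K$. Then the function $t\mapsto u_\infty(\boldsymbol{\alpha}_\infty(t))$ is convex on $0\le t\le T$. In particular, the speed $|\nabla u_\infty(\boldsymbol{\alpha}_\infty(t))|$ is a non-decreasing function of $t$.
   Context: $\Omega\subset\mathbb{R}^2$ is a bounded convex domain, $K\subset\Omega$ is a nonempty compact convex set (possibly a single point), and $G=\Omega\setminus K$. The function $u_\infty\in C(\overline G)$ is the unique viscosity solution of $$\Delta_\infty u=\sum_{i,j=1}^2\frac{\partial u}{\partial x_i}\frac{\partial u}{\partial x_j}\frac{\partial^2u}{\partial x_i\partial x_j}=0\ \text{ in } G,\qquad u=0\ \text{ on }\partial\Omega,\qquad u=1\ \text{ on }\partial K.$$ It is known that $u_\infty\in C^1(G)$ and $\nabla u_\infty\neq0$ in $G$. Standing assumption: $\nabla u_\infty$ extends continuously to $\overline\Omega\setminus K$; on $\partial\Omega$ the symbol $\nabla u_\infty$ denotes this extension. The curve $\boldsymbol{\alpha}_\infty(t)$ lies in $\overline\Omega\setminus K$ for $0\le t<T$. *)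

theory Defs
  imports "HOL-Analysis.Analysis"
begin

text \<open>
  Partial derivatives are read off the Frechet derivative, so they are only meaningful at points of
  differentiability; all uses below are under \<open>C2_on\<close>.
\<close>

definition partial_deriv :: "'n::finite \<Rightarrow> (real^'n \<Rightarrow> real) \<Rightarrow> real^'n \<Rightarrow> real" where
  "partial_deriv i f x = frechet_derivative f (at x) (axis i 1)"

definition C1_on :: "(real^'n::finite) set \<Rightarrow> (real^'n \<Rightarrow> real) \<Rightarrow> bool" where
  "C1_on S f \<longleftrightarrow>
     (\<forall>x\<in>S. f differentiable (at x)) \<and> (\<forall>i. continuous_on S (partial_deriv i f))"

definition C2_on :: "(real^'n::finite) set \<Rightarrow> (real^'n \<Rightarrow> real) \<Rightarrow> bool" where
  "C2_on S f \<longleftrightarrow> C1_on S f \<and> (\<forall>i. C1_on S (partial_deriv i f))"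

definition inf_Laplacian :: "(real^'n::finite \<Rightarrow> real) \<Rightarrow> real^'n \<Rightarrow> real" where
  "inf_Laplacian f x =
     (\<Sum>i\<in>UNIV. \<Sum>j\<in>UNIV.
        partial_deriv i f x * partial_deriv j f x * partial_deriv i (partial_deriv j f) x)"

text \<open>
  Test functions touch \<open>u\<close> at \<open>x\<close> from above (subsolutions) or below (supersolutions) and are only
  required to be twice continuously differentiable, and ordered with respect to \<open>u\<close>, near \<open>x\<close>.
\<close>

definition inf_subharmonic_viscosity :: "(real^'n::finite) set \<Rightarrow> (real^'n \<Rightarrow> real) \<Rightarrow> bool" where
  "inf_subharmonic_viscosity G u \<longleftrightarrow>
     (\<forall>\<phi> U x. open U \<and> U \<subseteq> G \<and> x \<in> U \<and> C2_on U \<phi> \<and>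
        \<phi> x = u x \<and> (\<forall>y\<in>U. u y \<le> \<phi> y) \<longrightarrow> inf_Laplacian \<phi> x \<ge> 0)"

definition inf_superharmonic_viscosity :: "(real^'n::finite) set \<Rightarrow> (real^'n \<Rightarrow> real) \<Rightarrow> bool" where
  "inf_superharmonic_viscosity G u \<longleftrightarrow>
     (\<forall>\<phi> U x. open U \<and> U \<subseteq> G \<and> x \<in> U \<and> C2_on U \<phi> \<and>
        \<phi> x = u x \<and> (\<forall>y\<in>U. \<phi> y \<le> u y) \<longrightarrow> inf_Laplacian \<phi> x \<le> 0)"

definition inf_harmonic_viscosity :: "(real^'n::finite) set \<Rightarrow> (real^'n \<Rightarrow> real) \<Rightarrow> bool" where
  "inf_harmonic_viscosity G u \<longleftrightarrow>
     continuous_on G u \<and> inf_subharmonic_viscosity G u \<and> inf_superharmonic_viscosity G u"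

end

theory Submission
  imports Defs
begin

text \<open>
  Comparison with cones makes the maximum of \<open>u\<close> over the ball of radius \<open>r\<close> about \<open>x\<close> a convex
  function of \<open>r\<close>, and likewise for \<open>- u\<close>. With the averaging trick of Armstrong and Smart this
  yields that \<open>u\<close>, extended by \<open>1\<close> on \<open>K\<close> and by \<open>0\<close> outside \<open>\<Omega>\<close>, is quasiconcave.

  Let \<open>C\<close> be a superlevel set of \<open>u\<close>, now known to be convex. If \<open>y\<close> is the point of \<open>C\<close> closest to
  \<open>x\<close>, then the cone estimate on the ball about \<open>x\<close> through \<open>y\<close> gives
  \<open>\<bar>\<nabla>u(x)\<bar> \<le> \<bar>\<nabla>u(y)\<bar>\<close>. Starting on the streamline and projecting successively onto the
  superlevel sets of \<open>u(\<alpha>(t\<^sub>1)), u(\<alpha>(t\<^sub>2)), \<dots>\<close> produces points with non-decreasing \<open>\<bar>\<nabla>u\<bar>\<close>.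
  Projections onto convex sets are non-expansive, and a single projection of \<open>\<alpha>(t\<^sub>k)\<close> misses
  \<open>\<alpha>(t\<^sub>k\<^sub>+\<^sub>1)\<close> by \<open>o(t\<^sub>k\<^sub>+\<^sub>1 - t\<^sub>k)\<close> only, so these points converge to the streamline as the
  partition is refined. Hence \<open>\<bar>\<nabla>u(\<alpha>(t))\<bar>\<close>, whose square is the derivative of \<open>u(\<alpha>(t))\<close>, is
  non-decreasing.
\<close>

section \<open>Comparison with cones\<close>

lemma partial_deriv_eq:
  assumes "(f has_derivative f') (at x)"
  shows "partial_deriv i f x = f' (axis i 1)"
  unfolding partial_deriv_def frechet_derivative_at[OF assms, symmetric] ..

definition radial :: "'a::real_inner \<Rightarrow> real \<Rightarrow> real \<Rightarrow> real \<Rightarrow> 'a \<Rightarrow> real" where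
  "radial p a b e y = a + b * norm (y - p) - e * (norm (y - p))\<^sup>2"

lemma has_derivative_norm_diff:
  fixes p :: "'a::real_inner"
  assumes "y \<noteq> p"
  shows "((\<lambda>y. norm (y - p)) has_derivative (\<lambda>h. ((y - p) \<bullet> h) / norm (y - p))) (at y)"
proof -
  have "((\<lambda>y. y - p) has_derivative (\<lambda>h. h)) (at y)"
    by (auto intro!: derivative_eq_intros)
  then have "((\<lambda>y. norm (y - p)) has_derivative (\<lambda>h. h \<bullet> sgn (y - p))) (at y)"
    by (rule has_derivative_compose[OF _ has_derivative_norm]) (use assms in simp)
  then show ?thesis
    by (simp add: sgn_div_norm inner_commute divide_inverse_commute)
qed

lemma has_derivative_radial:
  fixes p :: "'a::real_inner"
  assumes "y \<noteq> p"
  shows "(radial p a b e has_derivative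
    (\<lambda>h. (b / norm (y - p) - 2 * e) * ((y - p) \<bullet> h))) (at y)"
proof -
  have n: "norm (y - p) \<noteq> 0" using assms by simp
  have "((\<lambda>y. a + b * norm (y - p) - e * (norm (y - p))\<^sup>2) has_derivative
      (\<lambda>h. (b / norm (y - p) - 2 * e) * ((y - p) \<bullet> h))) (at y)"
    apply (rule derivative_eq_intros has_derivative_norm_diff[OF assms] refl)+
    using n by (auto simp: fun_eq_iff field_simps)
  then show ?thesis
    unfolding radial_def[abs_def] .
qed

lemma partial_deriv_radial:
  fixes p :: "real^'n::finite"
  assumes "y \<noteq> p"
  shows "partial_deriv j (radial p a b e) y = (b / norm (y - p) - 2 * e) * (y - p) $ j"
  using partial_deriv_eq[OF has_derivative_radial[OF assms]] by (simp add: inner_axis)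

lemma has_derivative_partial_radial:
  fixes p :: "real^'n::finite"
  assumes "y \<noteq> p"
  shows "(partial_deriv j (radial p a b e) has_derivative
    (\<lambda>h. (b / norm (y - p) - 2 * e) * h $ j
        - b / norm (y - p) ^ 3 * ((y - p) \<bullet> h) * (y - p) $ j)) (at y)"
proof -
  have n: "norm (y - p) \<noteq> 0" using assms by simp
  have "((\<lambda>y. (b / norm (y - p) - 2 * e) * (y - p) $ j) has_derivative
    (\<lambda>h. (b / norm (y - p) - 2 * e) * h $ j
        - b / norm (y - p) ^ 3 * ((y - p) \<bullet> h) * (y - p) $ j)) (at y)"
    apply (rule derivative_eq_intros has_derivative_norm_diff[OF assms] bounded_linear.has_derivative[OF bounded_linear_vec_nth] refl n)+
    using n by (auto simp: fun_eq_iff field_simps power3_eq_cube)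
  then show ?thesis
    by (rule has_derivative_transform_within_open[where s = "- {p}"])
      (use assms in \<open>auto simp: partial_deriv_radial\<close>)
qed

lemma partial_deriv_partial_radial:
  fixes p :: "real^'n::finite"
  assumes "y \<noteq> p"
  shows "partial_deriv i (partial_deriv j (radial p a b e)) y =
    (b / norm (y - p) - 2 * e) * axis i 1 $ j - b / norm (y - p) ^ 3 * (y - p) $ i * (y - p) $ j"
  using partial_deriv_eq[OF has_derivative_partial_radial[OF assms]] by (simp add: inner_axis)

lemma C2_on_radial:
  fixes p :: "real^'n::finite"
  assumes "p \<notin> S"
  shows "C2_on S (radial p a b e)"
proof -
  have ne: "y \<noteq> p" if "y \<in> S" for y using that assms by auto
  have "continuous_on S (\<lambda>y. (b / norm (y - p) - 2 * e) * (y - p) $ j)" for j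
    by (intro continuous_intros) (use ne in auto)
  then have c1: "continuous_on S (partial_deriv j (radial p a b e))" for j
    by (simp add: ne partial_deriv_radial cong: continuous_on_cong)
  have "continuous_on S (\<lambda>y. (b / norm (y - p) - 2 * e) * axis i 1 $ j
      - b / norm (y - p) ^ 3 * (y - p) $ i * (y - p) $ j)" for i j
    by (intro continuous_intros) (use ne in auto)
  then have c2: "continuous_on S (partial_deriv i (partial_deriv j (radial p a b e)))" for i j
    by (simp add: ne partial_deriv_partial_radial cong: continuous_on_cong)
  show ?thesis
    unfolding C2_on_def C1_on_def
    using c1 c2 has_derivative_radial[OF ne] has_derivative_partial_radial[OF ne]
    unfolding differentiable_def by blast
qed

text \<open>A radial function with profile f has infinity Laplacian f'(r)^2 f''(r); here f'(r) = b -
  2 e r and f''(r) = - 2 e. So pure cones are infinity harmonic off the vertex, and \<open>e\<close>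
  alone decides the sign.\<close>

lemma inf_Laplacian_radial:
  fixes p :: "real^'n::finite"
  assumes "y \<noteq> p"
  shows "inf_Laplacian (radial p a b e) y =
    - 2 * e * (b / norm (y - p) - 2 * e)\<^sup>2 * (norm (y - p))\<^sup>2"
proof -
  define d where "d = y - p"
  define r where "r = norm d"
  define s where "s = b / r - 2 * e"
  have r: "r \<noteq> 0" using assms by (simp add: r_def d_def)
  have r2: "(\<Sum>i\<in>UNIV. d $ i * d $ i) = r\<^sup>2"
    by (simp add: r_def power2_norm_eq_inner inner_vec_def)
  have "inf_Laplacian (radial p a b e) y =
    (\<Sum>i\<in>UNIV. \<Sum>j\<in>UNIV. (s * d $ i) * (s * d $ j) *
        (s * axis i 1 $ j - b / r ^ 3 * d $ i * d $ j))"
    unfolding inf_Laplacian_def partial_deriv_radial[OF assms]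
      partial_deriv_partial_radial[OF assms] s_def r_def d_def ..
  also have "\<dots> = (\<Sum>i\<in>UNIV. \<Sum>j\<in>UNIV. s ^ 3 * d $ i * (d $ j * axis i 1 $ j)
        - s\<^sup>2 * (b / r ^ 3) * (d $ i * d $ i) * (d $ j * d $ j))"
    by (intro sum.cong refl) (simp add: algebra_simps power2_eq_square power3_eq_cube)
  also have "\<dots> = (\<Sum>i\<in>UNIV. s ^ 3 * d $ i * (d \<bullet> axis i 1) - s\<^sup>2 * (b / r ^ 3) * (d $ i * d $ i) * r\<^sup>2)"
    by (simp add: sum_subtractf sum_distrib_left[symmetric] r2 inner_vec_def del: times_divide_eq_left times_divide_eq_right)
  also have "\<dots> = (\<Sum>i\<in>UNIV. s ^ 3 * (d $ i * d $ i) - s\<^sup>2 * (b / r ^ 3) * r\<^sup>2 * (d $ i * d $ i))"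
    by (simp add: inner_axis mult_ac)
  also have "\<dots> = s ^ 3 * r\<^sup>2 - s\<^sup>2 * (b / r ^ 3) * r\<^sup>2 * r\<^sup>2"
    by (simp add: sum_subtractf sum_distrib_left[symmetric] r2 del: times_divide_eq_left times_divide_eq_right)
  also have "\<dots> = s\<^sup>2 * (s * r\<^sup>2 - b * r)"
    using r by (simp add: field_simps power2_eq_square power3_eq_cube)
  also have "s * r\<^sup>2 - b * r = - 2 * e * r\<^sup>2"
    using r by (simp add: s_def field_simps power2_eq_square)
  finally show ?thesis by (simp add: s_def r_def d_def)
qed

text \<open>
  For small \<open>e > 0\<close> the perturbed cone \<open>radial p a b e\<close> is strictly infinity superharmonic, so it
  cannot touch \<open>u\<close> from above in \<open>U\<close>.
\<close>

lemma inf_subharmonic_le_cone: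
  fixes u :: "real^'n::finite \<Rightarrow> real"
  assumes sub: "inf_subharmonic_viscosity G u"
    and "compact C" "continuous_on C u" "open U" "U \<subseteq> G" "U \<subseteq> C" "p \<notin> U" "b > 0"
    and bd: "\<And>x. x \<in> C - U \<Longrightarrow> u x \<le> a + b * norm (x - p)"
    and "x \<in> C"
  shows "u x \<le> a + b * norm (x - p)"
proof (rule ccontr)
  assume nle: "\<not> ?thesis"
  \<comment> \<open>Half of the supposed violation; the other half absorbs the quadratic
    perturbation on \<open>C - U\<close>.\<close>
  define k where "k = (u x - (a + b * norm (x - p))) / 2"
  have k: "k > 0" using nle by (simp add: k_def)
  obtain R where R: "R > 0" "\<And>y. y \<in> C \<Longrightarrow> norm (y - p) \<le> R"
  proof -
    have "bounded ((\<lambda>y. y - p) ` C)"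
      by (intro compact_imp_bounded compact_continuous_image continuous_intros \<open>compact C\<close>)
    then show ?thesis using that unfolding bounded_pos by auto
  qed
  \<comment> \<open>The first bound keeps the maximiser \<open>z\<close> off \<open>C - U\<close>,
    the second keeps the slope b - 2 e r of the profile positive on \<open>C\<close>, so that the
    Laplacian is strictly negative.\<close>
  define e where "e = min (k / R\<^sup>2) (b / (4 * R))"
  have e: "e > 0" using k R \<open>b > 0\<close> by (simp add: e_def)
  have "e \<le> k / R\<^sup>2" "e \<le> b / (4 * R)" by (simp_all add: e_def)
  then have eR: "e * R\<^sup>2 \<le> k" "4 * e * R \<le> b"
    using R by (simp_all add: field_simps)
  have "continuous_on C (\<lambda>y. u y - radial p a b e y)"
    unfolding radial_def by (intro continuous_intros \<open>continuous_on C u\<close>)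
  then obtain z where z: "z \<in> C"
    "\<And>y. y \<in> C \<Longrightarrow> u y - radial p a b e y \<le> u z - radial p a b e z"
    using continuous_attains_sup[OF \<open>compact C\<close>] \<open>x \<in> C\<close> by blast
  have "u z - radial p a b e z \<ge> u x - radial p a b e x" using z \<open>x \<in> C\<close> by blast
  also have "u x - radial p a b e x \<ge> 2 * k"
    using e by (simp add: radial_def k_def)
  finally have zk: "u z - radial p a b e z \<ge> 2 * k" .
  have "z \<in> U"
  proof (rule ccontr)
    assume "z \<notin> U"
    have "e * (norm (z - p))\<^sup>2 \<le> e * R\<^sup>2"
      using e R z by (intro mult_left_mono power_mono) auto
    then show False using bd[of z] z \<open>z \<notin> U\<close> zk eR k by (simp add: radial_def)
  qed
  then have zp: "z \<noteq> p" using \<open>p \<notin> U\<close> by auto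
  \<comment> \<open>Raising the perturbed cone by the maximal gap makes it touch \<open>u\<close>
    from above at \<open>z\<close>.\<close>
  define a' where "a' = a + (u z - radial p a b e z)"
  have rad: "radial p a' b e y = radial p a b e y + (u z - radial p a b e z)" for y
    by (simp add: radial_def a'_def)
  have "inf_Laplacian (radial p a' b e) z \<ge> 0"
  proof (rule sub[unfolded inf_subharmonic_viscosity_def, rule_format], intro conjI ballI)
    show "radial p a' b e z = u z" by (simp add: rad)
    show "u y \<le> radial p a' b e y" if "y \<in> U" for y
      using z(2)[of y] that \<open>U \<subseteq> C\<close> by (auto simp: rad)
  qed (use \<open>open U\<close> \<open>U \<subseteq> G\<close> \<open>z \<in> U\<close> C2_on_radial[OF \<open>p \<notin> U\<close>] in auto)
  moreover have "inf_Laplacian (radial p a' b e) z < 0"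
  proof -
    have n: "norm (z - p) > 0" "norm (z - p) \<le> R" using zp R z by auto
    have "e * norm (z - p) \<le> e * R" using e n by simp
    then have "4 * (e * norm (z - p)) \<le> b" using eR by linarith
    then have "b / norm (z - p) - 2 * e > 0" using n e \<open>b > 0\<close> by (simp add: field_simps)
    then show ?thesis unfolding inf_Laplacian_radial[OF zp] using n e by simp
  qed
  ultimately show False by simp
qed

section \<open>From super- to subharmonicity by negation\<close>

lemma inf_subharmonic_uminus:
  fixes u :: "real^'n::finite \<Rightarrow> real"
  assumes "inf_superharmonic_viscosity G u"
  shows "inf_subharmonic_viscosity G (\<lambda>x. - u x)"
  unfolding inf_subharmonic_viscosity_def
proof (intro allI impI, elim conjE)
  fix \<phi> U x
  assume U: "open U" "U \<subseteq> G" "x \<in> U" and C2: "C2_on U \<phi>"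
    and \<phi>: "\<phi> x = - u x" "\<forall>y\<in>U. - u y \<le> \<phi> y"
  have d: "\<phi> differentiable at y" if "y \<in> U" for y
    using C2 that by (simp add: C2_on_def C1_on_def)
  have d2: "partial_deriv i \<phi> differentiable at y" if "y \<in> U" for y i
    using C2 that by (simp add: C2_on_def C1_on_def)
  have neg: "partial_deriv i (\<lambda>x. - f x) y = - partial_deriv i f y"
    if "f differentiable at y" for f :: "real^'n \<Rightarrow> real" and y i
    using partial_deriv_eq[OF has_derivative_minus[OF that[unfolded frechet_derivative_works]]]
    by (simp add: partial_deriv_def)
  have tr: "((partial_deriv j (\<lambda>x. - \<phi> x)) has_derivative
      (\<lambda>h. - frechet_derivative (partial_deriv j \<phi>) (at y) h)) (at y)" if "y \<in> U" for y j
    by (rule has_derivative_transform_within_open[OF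
          has_derivative_minus[OF d2[OF that, unfolded frechet_derivative_works]] U(1) that])
      (simp add: neg d)
  have neg2: "partial_deriv i (partial_deriv j (\<lambda>x. - \<phi> x)) y = - partial_deriv i (partial_deriv j \<phi>) y"
    if "y \<in> U" for y i j
    using partial_deriv_eq[OF tr[OF that]] by (simp add: partial_deriv_def)
  have "C2_on U (\<lambda>x. - \<phi> x)"
    unfolding C2_on_def C1_on_def
  proof (intro conjI ballI allI)
    fix y i j
    show "continuous_on U (partial_deriv i (\<lambda>x. - \<phi> x))"
      by (rule continuous_on_eq[of _ "\<lambda>y. - partial_deriv i \<phi> y"])
        (use C2 d in \<open>simp_all add: C2_on_def C1_on_def neg continuous_on_minus\<close>)
    show "continuous_on U (partial_deriv i (partial_deriv j (\<lambda>x. - \<phi> x)))"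
      by (rule continuous_on_eq[of _ "\<lambda>y. - partial_deriv i (partial_deriv j \<phi>) y"])
        (use C2 in \<open>simp_all add: C2_on_def C1_on_def neg2 continuous_on_minus\<close>)
    show "(\<lambda>x. - \<phi> x) differentiable at y" if "y \<in> U"
      using d[OF that] by (rule differentiable_minus)
    show "partial_deriv i (\<lambda>x. - \<phi> x) differentiable at y" if "y \<in> U"
      using tr[OF that] unfolding differentiable_def by blast
  qed
  moreover have "- \<phi> x = u x" "\<forall>y\<in>U. - \<phi> y \<le> u y"
    using \<phi> by (auto simp: minus_le_iff)
  ultimately have "inf_Laplacian (\<lambda>x. - \<phi> x) x \<le> 0"
    using assms U unfolding inf_superharmonic_viscosity_def by blast
  moreover have "inf_Laplacian (\<lambda>x. - \<phi> x) x = - inf_Laplacian \<phi> x"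
    unfolding inf_Laplacian_def using U(3) d by (simp add: neg neg2 sum_negf)
  ultimately show "inf_Laplacian \<phi> x \<ge> 0" by simp
qed

section \<open>Suprema over balls and quasiconcavity\<close>

text \<open>For continuous \<open>f\<close> and \<open>r\<close> at least 0 this is a maximum;
  applied to \<open>- f\<close> it is minus the minimum of \<open>f\<close> over the ball.\<close>

definition supball :: "('a::metric_space \<Rightarrow> real) \<Rightarrow> real \<Rightarrow> 'a \<Rightarrow> real" where
  "supball f r x = Sup (f ` cball x r)"

lemma supball_attained:
  fixes f :: "'a::heine_borel \<Rightarrow> real"
  assumes "continuous_on UNIV f" "0 \<le> r"
  obtains y where "dist x y \<le> r" "supball f r x = f y" "\<And>z. dist x z \<le> r \<Longrightarrow> f z \<le> f y"
proof -
  obtain y where y: "y \<in> cball x r" "\<forall>z\<in>cball x r. f z \<le> f y"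
    using continuous_attains_sup[OF compact_cball, of x r f] assms
      continuous_on_subset[OF assms(1)] by (metis cball_eq_empty not_less subset_UNIV)
  have "supball f r x = f y"
    unfolding supball_def by (rule cSup_eq_maximum) (use y in auto)
  then show ?thesis using y that by auto
qed

lemma le_supball:
  fixes f :: "'a::heine_borel \<Rightarrow> real"
  assumes "continuous_on UNIV f" "dist x y \<le> r"
  shows "f y \<le> supball f r x"
proof -
  have "0 \<le> r" using assms(2) zero_le_dist[of x y] by linarith
  then show ?thesis
    using supball_attained[OF assms(1), of r x] assms(2) by metis
qed

lemma supball_le_iff:
  fixes f :: "'a::heine_borel \<Rightarrow> real"
  assumes "continuous_on UNIV f" "0 \<le> r"
  shows "supball f r x \<le> c \<longleftrightarrow> (\<forall>y. dist x y \<le> r \<longrightarrow> f y \<le> c)"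
proof -
  obtain y where "dist x y \<le> r" "supball f r x = f y" "\<And>z. dist x z \<le> r \<Longrightarrow> f z \<le> f y"
    using supball_attained[OF assms] by blast
  then show ?thesis by force
qed

lemma supball_mono:
  fixes f :: "'a::heine_borel \<Rightarrow> real"
  assumes "continuous_on UNIV f" "0 \<le> r" "dist x' x + r \<le> r'"
  shows "supball f r x \<le> supball f r' x'"
  unfolding supball_le_iff[OF assms(1,2)]
proof (intro allI impI)
  fix y assume "dist x y \<le> r"
  then have "dist x' y \<le> r'" using assms(3) dist_triangle[of x' y x] by linarith
  then show "f y \<le> supball f r' x'" by (rule le_supball[OF assms(1)])
qed

text \<open>Closed balls add up: the intermediate point divides the segment from \<open>x\<close> to
  \<open>q\<close> in the ratio \<open>s : r\<close>. Hence enlarging the radius by \<open>s\<close>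
  amounts to moving the centre by at most \<open>s\<close>.\<close>

lemma dist_split:
  fixes x q :: "'a::real_normed_vector"
  assumes "dist x q \<le> r + s" "0 \<le> r" "0 \<le> s"
  obtains y where "dist x y \<le> s" "dist y q \<le> r"
proof (cases "r + s = 0")
  case True
  then show ?thesis using that[of x] assms by simp
next
  case False
  then have rs: "r + s > 0" using assms by simp
  define y where "y = x + (s / (r + s)) *\<^sub>R (q - x)"
  have "dist x y = (s / (r + s)) * dist x q"
    using rs assms by (simp add: y_def dist_norm norm_minus_commute)
  also have "\<dots> \<le> (s / (r + s)) * (r + s)"
    using rs assms by (intro mult_left_mono) auto
  finally have 1: "dist x y \<le> s" using rs by simp
  have "y - q = (r / (r + s)) *\<^sub>R (x - q)"
  proof -
    have s: "s / (r + s) = 1 - r / (r + s)" using rs by (simp add: field_simps)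
    show ?thesis unfolding y_def s by (simp add: algebra_simps)
  qed
  then have "dist y q = (r / (r + s)) * dist x q"
    using rs assms by (simp add: dist_norm)
  also have "\<dots> \<le> (r / (r + s)) * (r + s)"
    using rs assms by (intro mult_left_mono) auto
  finally have 2: "dist y q \<le> r" using rs by simp
  show ?thesis using that 1 2 by blast
qed

lemma supball_add_attained:
  fixes f :: "'a::{heine_borel,real_normed_vector} \<Rightarrow> real"
  assumes "continuous_on UNIV f" "0 \<le> r" "0 \<le> s"
  obtains y where "dist x y \<le> s" "supball f (r + s) x \<le> supball f r y"
proof -
  obtain q where q: "dist x q \<le> r + s" "supball f (r + s) x = f q"
    using supball_attained[OF assms(1), of "r + s" x] assms by (metis add_nonneg_nonneg)
  obtain y where "dist x y \<le> s" "dist y q \<le> r"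
    using dist_split[OF q(1)] assms by blast
  then show ?thesis using that le_supball[OF assms(1), of y q r] q by simp
qed

text \<open>Every point of the second ball is within \<open>d\<close> of the first, so radius and
  centre can vary together at the cost of the modulus of continuity of \<open>f\<close>.\<close>

lemma supball_uniform:
  fixes f :: "'a::{heine_borel,real_normed_vector} \<Rightarrow> real"
  assumes "continuous_on UNIV f" "0 \<le> r" "0 \<le> r'" "0 \<le> d" "dist x x' + r' \<le> r + d"
    and f: "\<And>a b. dist a b \<le> d \<Longrightarrow> f a \<le> f b + c"
  shows "supball f r' x' \<le> supball f r x + c"
  unfolding supball_le_iff[OF assms(1,3)]
proof (intro allI impI)
  fix q assume "dist x' q \<le> r'"
  then have "dist x q \<le> d + r" using assms(5) dist_triangle[of x q x'] by linarith
  then obtain y where y: "dist x y \<le> r" "dist y q \<le> d"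
    using dist_split[of x q d r] assms by blast
  then have "f q \<le> f y + c" using f by (simp add: dist_commute)
  also have "f y \<le> supball f r x" by (rule le_supball[OF assms(1) y(1)])
  finally show "f q \<le> supball f r x + c" by simp
qed

lemma continuous_on_supball:
  fixes f :: "'a::{heine_borel,real_normed_vector} \<Rightarrow> real"
  assumes "uniformly_continuous_on UNIV f"
  shows "continuous_on ({0..} \<times> UNIV) (\<lambda>(r, x). supball f r x)"
  unfolding continuous_on_iff
proof (intro ballI allI impI)
  have c: "continuous_on UNIV f" using assms by (rule uniformly_continuous_imp_continuous)
  fix p :: "real \<times> 'a" and e :: real
  assume p: "p \<in> {0..} \<times> UNIV" and "0 < e"
  obtain d where d: "d > 0" "\<And>a b. dist a b < d \<Longrightarrow> dist (f a) (f b) < e / 2"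
    using assms \<open>0 < e\<close> unfolding uniformly_continuous_on_def
    by (metis UNIV_I half_gt_zero dist_commute)
  have fd: "f a \<le> f b + e / 2" if "dist a b \<le> d / 2" for a b
  proof -
    have "\<bar>f a - f b\<bar> < e / 2" using d(2)[of a b] d(1) that unfolding dist_real_def by linarith
    then show ?thesis by linarith
  qed
  show "\<exists>d>0. \<forall>q\<in>{0..} \<times> UNIV. dist q p < d \<longrightarrow>
      dist (case q of (r, x) \<Rightarrow> supball f r x) (case p of (r, x) \<Rightarrow> supball f r x) < e"
  proof (intro exI[of _ "d / 4"] conjI ballI impI)
    fix q :: "real \<times> 'a" assume q: "q \<in> {0..} \<times> UNIV" and dq: "dist q p < d / 4"
    obtain r x where pe: "p = (r, x)" by (cases p)
    obtain r' x' where qe: "q = (r', x')" by (cases q)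
    have "dist r' r < d / 4" "dist x' x < d / 4"
      using dq dist_fst_le[of q p] dist_snd_le[of q p] by (simp_all add: pe qe)
    then have "dist x x' + r' \<le> r + d / 2" "dist x' x + r \<le> r' + d / 2"
      unfolding dist_real_def dist_commute[of x x'] by linarith+
    then have "supball f r' x' \<le> supball f r x + e / 2" "supball f r x \<le> supball f r' x' + e / 2"
      using p q d(1) by (auto simp: pe qe intro!: supball_uniform[OF c, where d = "d / 2"] fd)
    then show "dist (case q of (r, x) \<Rightarrow> supball f r x) (case p of (r, x) \<Rightarrow> supball f r x) < e"
      using \<open>0 < e\<close> by (auto simp: pe qe dist_real_def)
  qed (use d in simp)
qed

lemma continuous_on_supball_compose:
  fixes f :: "'a::{heine_borel,real_normed_vector} \<Rightarrow> real"
  assumes "uniformly_continuous_on UNIV f" "continuous_on S g" "continuous_on S h"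
    "\<And>x. x \<in> S \<Longrightarrow> 0 \<le> g x"
  shows "continuous_on S (\<lambda>x. supball f (g x) (h x))"
  using continuous_on_compose2[OF continuous_on_supball[OF assms(1)]
      continuous_on_Pair[OF assms(2,3)]] assms(4)
  by auto

section \<open>The maximisation argument for quasiconcavity\<close>

lemma continuous_attains_lex_sup:
  fixes f g h :: "'a::topological_space \<Rightarrow> real"
  assumes "compact S" "S \<noteq> {}" "continuous_on S f" "continuous_on S g" "continuous_on S h"
  obtains p where "p \<in> S" "\<And>q. q \<in> S \<Longrightarrow> f q \<le> f p"
    "\<And>q. q \<in> S \<Longrightarrow> f p \<le> f q \<Longrightarrow> g q \<le> g p"
    "\<And>q. q \<in> S \<Longrightarrow> f p \<le> f q \<Longrightarrow> g p \<le> g q \<Longrightarrow> h q \<le> h p"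
proof -
  \<comment> \<open>Superlevel sets are used for the successive sets of maximisers because they stay
    compact.\<close>
  have cpt: "compact {x \<in> T. c \<le> k x}" if T: "compact T" "continuous_on T k"
    for T and k :: "'a \<Rightarrow> real" and c
  proof -
    obtain A where "closed A" "A \<inter> T = k -` {c..} \<inter> T"
      using T(2) closed_atLeast[of c] unfolding continuous_on_closed_invariant by blast
    moreover have "{x \<in> T. c \<le> k x} = k -` {c..} \<inter> T" by auto
    ultimately show ?thesis using compact_Int_closed[OF T(1)] by (metis inf_commute)
  qed
  obtain p1 where p1: "p1 \<in> S" "\<forall>q\<in>S. f q \<le> f p1"
    using continuous_attains_sup[OF assms(1-3)] by blast
  define E where "E = {x \<in> S. f p1 \<le> f x}"
  have E: "compact E" "E \<noteq> {}" "E \<subseteq> S"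
    using cpt[OF assms(1,3)] p1 by (auto simp: E_def)
  obtain p2 where p2: "p2 \<in> E" "\<forall>q\<in>E. g q \<le> g p2"
    using continuous_attains_sup[OF E(1,2) continuous_on_subset[OF assms(4) E(3)]] by blast
  define F where "F = {x \<in> E. g p2 \<le> g x}"
  have F: "compact F" "F \<noteq> {}" "F \<subseteq> S"
    using cpt[OF E(1) continuous_on_subset[OF assms(4) E(3)]] p2 E by (auto simp: F_def)
  obtain p where p: "p \<in> F" "\<forall>q\<in>F. h q \<le> h p"
    using continuous_attains_sup[OF F(1,2) continuous_on_subset[OF assms(5) F(3)]] by blast
  show ?thesis
  proof (rule that[of p])
    show "p \<in> S" using p F by auto
    show "f q \<le> f p" if "q \<in> S" for q using p p1 that by (force simp: F_def E_def)
    show "g q \<le> g p" if "q \<in> S" "f p \<le> f q" for q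
      using p p2 that by (force simp: F_def E_def)
    show "h q \<le> h p" if "q \<in> S" "f p \<le> f q" "g p \<le> g q" for q
      using p that by (force simp: F_def E_def)
  qed
qed

lemma convex_comb_dist:
  fixes y z :: "'a::real_normed_vector"
  assumes "0 \<le> l" "l \<le> 1" "dist y y' \<le> r" "dist z z' \<le> s"
  shows "dist (l *\<^sub>R y + (1 - l) *\<^sub>R z) (l *\<^sub>R y' + (1 - l) *\<^sub>R z') \<le> l * r + (1 - l) * s"
proof -
  have "dist (l *\<^sub>R y + (1 - l) *\<^sub>R z) (l *\<^sub>R y' + (1 - l) *\<^sub>R z') =
      norm (l *\<^sub>R (y - y') + (1 - l) *\<^sub>R (z - z'))"
    by (simp add: dist_norm algebra_simps)
  also have "\<dots> \<le> l * norm (y - y') + (1 - l) * norm (z - z')"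
    using norm_triangle_ineq[of "l *\<^sub>R (y - y')" "(1 - l) *\<^sub>R (z - z')"] assms by simp
  also have "\<dots> \<le> l * r + (1 - l) * s"
    using assms by (intro add_mono mult_left_mono) (auto simp: dist_norm)
  finally show ?thesis .
qed

text \<open>
  With \<open>V\<close> and \<open>N\<close> the suprema of \<open>e\<close> and \<open>- e\<close> over balls of a small radius \<open>\<epsilon>\<close>, maximise
  \<open>min (V y) (V z) + N x\<close> for \<open>x = l y + (1 - l) z\<close>, then the level \<open>min (V y) (V z)\<close> among the
  maximisers, and finally a linear functional of \<open>x\<close>. Displacements of \<open>y\<close> and \<open>z\<close> by at most \<open>r\<close>
  and \<open>s\<close> produce all displacements of \<open>x\<close> by at most \<open>\<delta> = l r + (1 - l) s\<close>. If \<open>r\<close> and \<open>s\<close> are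
  chosen such that \<open>V\<close> drops by the same amount \<open>k'\<close> around \<open>y\<close> and \<open>z\<close>, then convexity in the
  radius forces \<open>V\<close> to rise by \<open>k'\<close> as well, while \<open>N\<close> changes by at most \<open>k'\<close> in either direction.
  By maximality of the level everything is flat, so \<open>x\<close> can be moved in any direction.
\<close>

lemma quasiconcave_of_supball_convex:
  fixes e :: "'a::euclidean_space \<Rightarrow> real"
  assumes uc: "uniformly_continuous_on UNIV e"
    and \<Omega>: "bounded \<Omega>" "convex \<Omega>" and K: "compact K" "convex K" "K \<noteq> {}" "K \<subseteq> \<Omega>"
    and e01: "\<And>x. 0 \<le> e x" "\<And>x. e x \<le> 1"
    and eoff: "\<And>x. x \<notin> \<Omega> \<Longrightarrow> e x = 0" and eK: "\<And>x. x \<in> K \<Longrightarrow> e x = 1"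
    and eless: "\<And>x. x \<notin> K \<Longrightarrow> e x < 1"
    and mid: "\<And>y r s. \<lbrakk>cball y (r + s) \<subseteq> \<Omega> - K; 0 \<le> s; s \<le> r\<rbrakk> \<Longrightarrow>
      2 * supball e r y \<le> supball e (r - s) y + supball e (r + s) y"
    and midn: "\<And>y r s. \<lbrakk>cball y (r + s) \<subseteq> \<Omega> - K; 0 \<le> s; s \<le> r\<rbrakk> \<Longrightarrow>
      2 * supball (\<lambda>x. - e x) r y \<le> supball (\<lambda>x. - e x) (r - s) y + supball (\<lambda>x. - e x) (r + s) y"
    and l01: "0 \<le> l" "l \<le> 1"
  shows "min (e y0) (e z0) \<le> e (l *\<^sub>R y0 + (1 - l) *\<^sub>R z0)"
proof (rule ccontr)
  assume neg: "\<not> ?thesis"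
  have l: "0 < l" "l < 1"
    using neg l01 by (auto simp: less_le)
  define D where "D = min (e y0) (e z0) - e (l *\<^sub>R y0 + (1 - l) *\<^sub>R z0)"
  have D: "D > 0" using neg by (simp add: D_def not_le)
  have c: "continuous_on UNIV e" using uc by (rule uniformly_continuous_imp_continuous)
  have ucn: "uniformly_continuous_on UNIV (\<lambda>x. - e x)"
    using uc by (rule uniformly_continuous_on_minus)
  have cn: "continuous_on UNIV (\<lambda>x. - e x)" using ucn by (rule uniformly_continuous_imp_continuous)
  have uce: "\<exists>d>0. \<forall>a b. dist a b < d \<longrightarrow> \<bar>e a - e b\<bar> < t" if "t > 0" for t
    using uc that unfolding uniformly_continuous_on_def dist_real_def
    by (metis UNIV_I abs_minus_commute)
  obtain d1 where d1: "d1 > 0" "\<And>a b. dist a b < d1 \<Longrightarrow> \<bar>e a - e b\<bar> < D / 2"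
    using uce[of "D / 2"] D by auto
  \<comment> \<open>Within \<open>d1\<close> of \<open>K\<close> the values exceed
    \<open>1 - D / 2\<close>. The quarter leaves room for two additional radii \<epsilon>.\<close>
  define \<tau> where "\<tau> = d1 / 4"
  have \<tau>: "\<tau> > 0" "2 * \<tau> < d1" using d1 by (simp_all add: \<tau>_def)
  \<comment> \<open>Values near 1 force closeness to \<open>K\<close>: on the compact part
    \<open>S\<close> of the closure of \<Omega> at distance at least \<tau> from \<open>K\<close>,
    the maximum of \<open>e\<close> is below 1.\<close>
  obtain \<eta>1 where \<eta>1: "\<eta>1 > 0" "\<And>p. e p \<ge> 1 - \<eta>1 \<Longrightarrow> \<exists>k\<in>K. dist p k \<le> \<tau>"
  proof -
    define S where "S = {p \<in> closure \<Omega>. infdist p K \<ge> \<tau>}"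
    have "compact S"
    proof -
      have "closed {p. infdist p K \<ge> \<tau>}"
        by (intro closed_Collect_le continuous_intros)
      then have "compact (closure \<Omega> \<inter> {p. infdist p K \<ge> \<tau>})"
        using \<Omega>(1) by (intro compact_Int_closed) (auto simp: compact_closure)
      then show ?thesis by (simp add: S_def Collect_conj_eq)
    qed
    have near: "\<exists>k\<in>K. dist p k \<le> \<tau>" if "p \<in> \<Omega>" "p \<notin> S" for p
    proof -
      have "infdist p K < \<tau>" using that closure_subset by (auto simp: S_def)
      moreover obtain k where "k \<in> K" "infdist p K = dist p k"
        using infdist_attains_inf[of K p] K compact_imp_closed by blast
      ultimately show ?thesis by force
    qed
    have inO: "p \<in> \<Omega>" if "e p > 0" for p using eoff[of p] that by auto
    show thesis
    proof (cases "S = {}")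
      case True
      show thesis
        by (rule that[of "1/2"]) (use near inO True in force)+
    next
      case False
      obtain q where q: "q \<in> S" "\<forall>p\<in>S. e p \<le> e q"
        using continuous_attains_sup[OF \<open>compact S\<close> False continuous_on_subset[OF c]] by blast
      have "q \<notin> K" using q(1) \<tau> by (auto simp: S_def)
      then have "e q < 1" by (rule eless)
      define t where "t = (1 - e q) / 2"
      show thesis
      proof (rule that[of t])
        show "t > 0" using \<open>e q < 1\<close> by (simp add: t_def)
        fix p assume "1 - t \<le> e p"
        then have "e p > e q" "e p > 0" using \<open>e q < 1\<close> e01[of q] by (auto simp: t_def field_simps)
        then show "\<exists>k\<in>K. dist p k \<le> \<tau>" using near inO q(2) by force
      qed
    qed
  qed
  define \<eta> where "\<eta> = min \<eta>1 (D / 2)"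
  obtain d2 where d2: "d2 > 0" "\<And>a b. dist a b < d2 \<Longrightarrow> \<bar>e a - e b\<bar> < \<eta>"
    using uce[of \<eta>] D \<eta>1 by (auto simp: \<eta>_def)
  \<comment> \<open>Three radii fit into \<open>d2\<close>: one for a point where \<open>V\<close>
    is attained and two for the safety ball of radius \<open>2 * \<epsilon>\<close>.\<close>
  define \<epsilon> where "\<epsilon> = min (d2 / 4) (\<tau> / 2)"
  have \<epsilon>: "\<epsilon> > 0" "3 * \<epsilon> < d2" "2 * \<epsilon> \<le> \<tau>"
    using d2 \<tau> by (auto simp: \<epsilon>_def)
  define V where "V = supball e \<epsilon>"
  define N where "N = supball (\<lambda>x. - e x) \<epsilon>"
  have V01: "0 \<le> V x" "V x \<le> 1" for x
    using supball_attained[OF c, of \<epsilon> x] \<epsilon> e01 unfolding V_def by (metis less_imp_le)+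
  have Ve: "e x \<le> V x" for x using le_supball[OF c, of x x \<epsilon>] \<epsilon> by (simp add: V_def)
  have Ne: "- e x \<le> N x" for x using le_supball[OF cn, of x x \<epsilon>] \<epsilon> by (simp add: N_def)
  have N0: "N x \<le> 0" for x
    unfolding N_def using supball_le_iff[OF cn, of \<epsilon> x 0] \<epsilon> e01 by simp
  define X where "X y z = l *\<^sub>R y + (1 - l) *\<^sub>R z" for y z :: 'a
  define L where "L y z = min (V y) (V z)" for y z
  define J where "J y z = L y z + N (X y z)" for y z
  have J0: "J y0 z0 \<ge> D"
    using Ve[of y0] Ve[of z0] Ne[of "X y0 z0"] by (auto simp: J_def L_def D_def X_def)
  obtain R0 where R0: "\<And>x. x \<in> \<Omega> \<Longrightarrow> norm x \<le> R0"
    using \<Omega>(1) by (auto simp: bounded_iff)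
  \<comment> \<open>Outside this ball \<open>V\<close> vanishes, and \<open>N\<close> is never
    positive; so a positive value of \<open>J\<close> is only possible on
    \<open>C \<times> C\<close>, and a maximum there is global.\<close>
  define C where "C = cball (0::'a) (R0 + \<epsilon>)"
  have VC: "x \<in> C" if "V x > 0" for x
  proof -
    obtain q where q: "dist x q \<le> \<epsilon>" "V x = e q"
      using supball_attained[OF c, of \<epsilon> x] \<epsilon> unfolding V_def by (metis less_imp_le)
    then have "norm q \<le> R0" using eoff[of q] that R0 by fastforce
    then show ?thesis using q(1) norm_triangle_ineq2[of x q] by (simp add: C_def dist_norm)
  qed
  have JC: "y \<in> C \<and> z \<in> C" if "J y z > 0" for y z
    using that N0[of "X y z"] VC[of y] VC[of z] by (auto simp: J_def L_def)
  have contV: "continuous_on S (\<lambda>x. V (h x))" "continuous_on S (\<lambda>x. N (h x))"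
    if "continuous_on S h" for S and h :: "'a \<times> 'a \<Rightarrow> 'a"
    unfolding V_def N_def
    by (intro continuous_on_supball_compose uc ucn that continuous_intros; use \<epsilon> in simp)+
  obtain b :: 'a where b: "b \<in> Basis" using nonempty_Basis by blast
  have "compact (C \<times> C)" by (simp add: C_def compact_Times)
  moreover have "C \<times> C \<noteq> {}" using JC[of y0 z0] J0 D by auto
  moreover have "continuous_on (C \<times> C) (\<lambda>p. J (fst p) (snd p))"
    "continuous_on (C \<times> C) (\<lambda>p. L (fst p) (snd p))"
    unfolding J_def L_def X_def by (intro continuous_intros contV)+
  moreover have "continuous_on (C \<times> C) (\<lambda>p. X (fst p) (snd p) \<bullet> b)"
    unfolding X_def by (intro continuous_intros)
  ultimately obtain p where p: "p \<in> C \<times> C"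
    "\<And>q. q \<in> C \<times> C \<Longrightarrow> J (fst q) (snd q) \<le> J (fst p) (snd p)"
    "\<And>q. q \<in> C \<times> C \<Longrightarrow> J (fst p) (snd p) \<le> J (fst q) (snd q) \<Longrightarrow> L (fst q) (snd q) \<le> L (fst p) (snd p)"
    "\<And>q. q \<in> C \<times> C \<Longrightarrow> J (fst p) (snd p) \<le> J (fst q) (snd q) \<Longrightarrow> L (fst p) (snd p) \<le> L (fst q) (snd q)
      \<Longrightarrow> X (fst q) (snd q) \<bullet> b \<le> X (fst p) (snd p) \<bullet> b"
    by (rule continuous_attains_lex_sup) (rule that)
  obtain y z where pyz: "p = (y, z)" by (cases p)
  define x where "x = X y z"
  define m where "m = L y z"
  define M where "M = J y z"
  have Meq: "M = m + N x" by (simp add: M_def m_def x_def J_def)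
  have MD: "D \<le> M"
    using p(2)[of "(y0, z0)"] JC[of y0 z0] J0 D by (auto simp: M_def pyz)
  have max1: "J y' z' \<le> M" for y' z'
    using p(2)[of "(y', z')"] JC[of y' z'] MD D by (force simp: M_def pyz)
  have max2: "L y' z' \<le> m" if "M \<le> J y' z'" for y' z'
    using p(3)[of "(y', z')"] JC[of y' z'] MD D that by (force simp: M_def m_def pyz)
  have max3: "X y' z' \<bullet> b \<le> x \<bullet> b" if "M \<le> J y' z'" "m \<le> L y' z'" for y' z'
    using p(4)[of "(y', z')"] JC[of y' z'] MD D that by (force simp: M_def m_def x_def pyz)
  have m1: "m \<le> 1" "m \<le> V y" "m \<le> V z" using V01 by (auto simp: m_def L_def min_le_iff_disj)
  \<comment> \<open>\<open>M\<close> is at least \<open>D\<close> and \<open>m\<close> at most 1, so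
    \<open>e\<close> drops to \<open>1 - D\<close> or less within \<epsilon> of \<open>x\<close>,
    which cannot happen near \<open>K\<close>.\<close>
  have farK: False if "k \<in> K" "dist x k \<le> r" "r + \<epsilon> < d1" for k r
  proof -
    obtain q where q: "dist x q \<le> \<epsilon>" "N x = - e q"
      using supball_attained[OF cn, of \<epsilon> x] \<epsilon> unfolding N_def by (metis less_imp_le)
    have "dist q k < d1" using q(1) that dist_triangle[of q k x] by (simp add: dist_commute)
    then have "e q > 1 - D / 2" using d1(2)[of q k] eK[OF that(1)] by linarith
    then show False using q(2) MD m1(1) D by (simp add: Meq)
  qed
  \<comment> \<open>Since \<open>N\<close> is never positive, \<open>m\<close> is at least
    \<open>D\<close>; near a point outside \<Omega> the values stay below
    \<open>D / 2\<close>.\<close>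
  have inO: "cball v (2 * \<epsilon>) \<subseteq> \<Omega>" if "m \<le> V v" for v
  proof (rule ccontr)
    assume "\<not> ?thesis"
    then obtain k where k: "dist v k \<le> 2 * \<epsilon>" "k \<notin> \<Omega>" unfolding subset_iff mem_cball by blast
    obtain q where q: "dist v q \<le> \<epsilon>" "V v = e q"
      using supball_attained[OF c, of \<epsilon> v] \<epsilon> unfolding V_def by (metis less_imp_le)
    have "dist q k < d2" using q(1) k \<epsilon> dist_triangle[of q k v] by (simp add: dist_commute)
    then have "e q < D / 2" using d2(2)[of q k] eoff[OF k(2)] e01(1)[of q] by (simp add: \<eta>_def)
    then show False using q(2) MD that N0[of x] D by (simp add: Meq)
  qed
  \<comment> \<open>Translating \<open>y\<close> and \<open>z\<close> by the same vector translates
    \<open>x\<close> by it, so convexity of \<Omega> transfers the room around \<open>y\<close> and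
    \<open>z\<close> to \<open>x\<close>.\<close>
  have xball: "cball x (2 * \<epsilon>) \<subseteq> \<Omega> - K"
  proof
    fix q assume q: "q \<in> cball x (2 * \<epsilon>)"
    have "q \<notin> K" using farK[of q "2 * \<epsilon>"] q \<epsilon> \<tau> by auto
    define h where "h = q - x"
    have "norm h \<le> 2 * \<epsilon>" using q by (simp add: h_def dist_norm norm_minus_commute)
    then have "y + h \<in> \<Omega>" "z + h \<in> \<Omega>"
      using inO[OF m1(2)] inO[OF m1(3)] by (auto simp: dist_norm subset_iff)
    then have "l *\<^sub>R (y + h) + (1 - l) *\<^sub>R (z + h) \<in> \<Omega>"
      using \<Omega>(2) l by (intro convexD) auto
    moreover have "l *\<^sub>R (y + h) + (1 - l) *\<^sub>R (z + h) = q"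
      by (simp add: h_def x_def X_def algebra_simps)
    ultimately show "q \<in> \<Omega> - K" using \<open>q \<notin> K\<close> by simp
  qed
  have key: False
    if \<delta>: "0 < \<delta>" "\<delta> \<le> \<epsilon>" "l * r + (1 - l) * s = \<delta>" and rs: "0 \<le> r" "r \<le> \<epsilon>" "0 \<le> s" "s \<le> \<epsilon>"
      and low: "m - k' \<le> supball e (\<epsilon> - r) y" "m - k' \<le> supball e (\<epsilon> - s) z"
      and up: "m + k' \<le> supball e (\<epsilon> + r) y" "m + k' \<le> supball e (\<epsilon> + s) z" "0 \<le> k'"
    for \<delta> r s k'
  proof -
    \<comment> \<open>The displacements of \<open>y\<close> and \<open>z\<close> are in proportion
      \<open>r : s\<close>, scaled so that their combination is exactly \<open>h\<close>.\<close>
    have Xmove: "X (y + (r / \<delta>) *\<^sub>R h) (z + (s / \<delta>) *\<^sub>R h) = x + h" for h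
    proof -
      have "X (y + (r / \<delta>) *\<^sub>R h) (z + (s / \<delta>) *\<^sub>R h) = x + ((l * r + (1 - l) * s) / \<delta>) *\<^sub>R h"
        by (simp add: X_def x_def algebra_simps add_divide_distrib diff_divide_distrib)
      then show ?thesis using \<delta> by simp
    qed
    \<comment> \<open>The \<epsilon>-ball about the displaced point still contains the shrunken ball
      about the original one.\<close>
    have Vmove: "m - k' \<le> V (y + (r / \<delta>) *\<^sub>R h)" "m - k' \<le> V (z + (s / \<delta>) *\<^sub>R h)"
      if "norm h \<le> \<delta>" for h
    proof -
      have "(r / \<delta>) * norm h \<le> (r / \<delta>) * \<delta>" "(s / \<delta>) * norm h \<le> (s / \<delta>) * \<delta>"
        using that \<delta> rs by (intro mult_left_mono; simp)+
      then have "norm ((r / \<delta>) *\<^sub>R h) \<le> r" "norm ((s / \<delta>) *\<^sub>R h) \<le> s"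
        using \<delta> rs by simp_all
      then have "dist (y + (r / \<delta>) *\<^sub>R h) y + (\<epsilon> - r) \<le> \<epsilon>" "dist (z + (s / \<delta>) *\<^sub>R h) z + (\<epsilon> - s) \<le> \<epsilon>"
        by (simp_all add: dist_norm)
      then have "supball e (\<epsilon> - r) y \<le> V (y + (r / \<delta>) *\<^sub>R h)" "supball e (\<epsilon> - s) z \<le> V (z + (s / \<delta>) *\<^sub>R h)"
        unfolding V_def using rs by (intro supball_mono[OF c]; simp)+
      then show "m - k' \<le> V (y + (r / \<delta>) *\<^sub>R h)" "m - k' \<le> V (z + (s / \<delta>) *\<^sub>R h)"
        using low by linarith+
    qed
    \<comment> \<open>The gain of \<open>N\<close> available within \<delta> of \<open>x\<close>.
      Moving \<open>y\<close> and \<open>z\<close> along realises it while the level loses at most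
      \<open>k'\<close>, so maximality of \<open>J\<close> gives \<open>k \<le> k'\<close>.\<close>
    define k where "k = supball (\<lambda>x. - e x) (\<epsilon> + \<delta>) x - N x"
    obtain x' where x': "dist x x' \<le> \<delta>" "supball (\<lambda>x. - e x) (\<epsilon> + \<delta>) x \<le> N x'"
      using supball_add_attained[OF cn, of \<epsilon> \<delta> x] \<epsilon> \<delta> unfolding N_def by (metis less_imp_le)
    define h where "h = x' - x"
    have h: "norm h \<le> \<delta>" using x' by (simp add: h_def dist_norm norm_minus_commute)
    have "m - k' + N x' \<le> J (y + (r / \<delta>) *\<^sub>R h) (z + (s / \<delta>) *\<^sub>R h)"
      using Vmove[OF h] by (simp add: J_def L_def Xmove) (simp add: h_def)
    then have kk: "k \<le> k'"
      using max1[of "y + (r / \<delta>) *\<^sub>R h" "z + (s / \<delta>) *\<^sub>R h"] x'(2) by (simp add: k_def Meq)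
    \<comment> \<open>Convexity in the radius turns a gain of \<open>k\<close> on enlarging the ball
      into a loss of at most \<open>k\<close> on shrinking it; this bounds \<open>N\<close> below
      throughout the \<delta>-ball.\<close>
    have "2 * N x \<le> supball (\<lambda>x. - e x) (\<epsilon> - \<delta>) x + supball (\<lambda>x. - e x) (\<epsilon> + \<delta>) x"
      unfolding N_def
    proof (rule midn)
      have "cball x (\<epsilon> + \<delta>) \<subseteq> cball x (2 * \<epsilon>)" using \<delta> by (intro subset_cball) simp
      then show "cball x (\<epsilon> + \<delta>) \<subseteq> \<Omega> - K" using xball by blast
    qed (use \<delta> in auto)
    then have "N x - k \<le> supball (\<lambda>x. - e x) (\<epsilon> - \<delta>) x" by (simp add: k_def)
    moreover have "supball (\<lambda>x. - e x) (\<epsilon> - \<delta>) x \<le> N v" if "dist x v \<le> \<delta>" for v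
      unfolding N_def using that \<delta> by (intro supball_mono[OF cn]) (auto simp: dist_commute)
    ultimately have Nlow: "N x - k \<le> N v" if "dist x v \<le> \<delta>" for v using that by fastforce
    \<comment> \<open>These points gain \<open>k'\<close> in level while \<open>N\<close> loses at
      most \<open>k\<close>; they maximise \<open>J\<close> as well, so maximality of the level
      forces \<open>k' = 0\<close>.\<close>
    obtain y' where y': "dist y y' \<le> r" "supball e (\<epsilon> + r) y \<le> V y'"
      using supball_add_attained[OF c, of \<epsilon> r y] \<epsilon> rs unfolding V_def by (metis less_imp_le)
    obtain z' where z': "dist z z' \<le> s" "supball e (\<epsilon> + s) z \<le> V z'"
      using supball_add_attained[OF c, of \<epsilon> s z] \<epsilon> rs unfolding V_def by (metis less_imp_le)
    have "dist x (X y' z') \<le> \<delta>"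
      using convex_comb_dist[OF l01 y'(1) z'(1)] \<delta> by (simp add: x_def X_def)
    then have "N x - k \<le> N (X y' z')" by (rule Nlow)
    moreover have Lk: "m + k' \<le> L y' z'" using y' z' up by (simp add: L_def)
    ultimately have "M \<le> J y' z'" using kk by (simp add: J_def Meq)
    then have "L y' z' \<le> m" by (rule max2)
    then have k0: "k' = 0" "k \<le> 0" using Lk up kk by auto
    \<comment> \<open>With nothing left to gain or lose, a shift along \<open>b\<close> preserves
      \<open>J\<close> and the level but increases the third functional.\<close>
    define h where "h = \<delta> *\<^sub>R b"
    have h: "norm h \<le> \<delta>" using b \<delta> by (simp add: h_def)
    have "m \<le> L (y + (r / \<delta>) *\<^sub>R h) (z + (s / \<delta>) *\<^sub>R h)"
      using Vmove[OF h] k0 by (simp add: L_def)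
    moreover have "N x \<le> N (X (y + (r / \<delta>) *\<^sub>R h) (z + (s / \<delta>) *\<^sub>R h))"
      unfolding Xmove using Nlow[of "x + h"] h k0 by (simp add: dist_norm)
    ultimately have "x \<bullet> b \<ge> X (y + (r / \<delta>) *\<^sub>R h) (z + (s / \<delta>) *\<^sub>R h) \<bullet> b"
      by (intro max3) (simp_all add: J_def Meq)
    then show False unfolding Xmove using b \<delta> by (simp add: h_def inner_add_left)
  qed
  have small: "\<exists>r>0. r \<le> \<epsilon> \<and> m \<le> supball e (\<epsilon> - r) v" if "m < V v" for v
  proof -
    have c0: "continuous_on {0..\<epsilon>} (\<lambda>r. supball e (\<epsilon> - r) v)"
      by (intro continuous_on_supball_compose uc continuous_intros) auto
    have "\<exists>d>0. \<forall>r\<in>{0..\<epsilon>}. dist r 0 < d \<longrightarrow>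
        dist (supball e (\<epsilon> - r) v) (supball e (\<epsilon> - 0) v) < V v - m"
      using c0[unfolded continuous_on_iff, THEN bspec[where x = 0], THEN spec[where x = "V v - m"]] that \<epsilon>
      by simp
    then obtain d where d: "d > 0"
      "\<And>r. r \<in> {0..\<epsilon>} \<Longrightarrow> dist r 0 < d \<Longrightarrow> dist (supball e (\<epsilon> - r) v) (V v) < V v - m"
      by (auto simp: V_def)
    define r where "r = min \<epsilon> (d / 2)"
    have "r \<in> {0..\<epsilon>}" "dist r 0 < d" using d(1) \<epsilon> by (auto simp: r_def)
    then have "m \<le> supball e (\<epsilon> - r) v"
      using d(2)[of r] unfolding dist_real_def by linarith
    then show ?thesis using d(1) \<epsilon> by (intro exI[of _ r]) (auto simp: r_def)
  qed
  have mono: "m \<le> supball e (\<epsilon> + r) v" if "m \<le> V v" "0 \<le> r" for v r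
    using supball_mono[OF c, of \<epsilon> v v "\<epsilon> + r"] that \<epsilon> by (simp add: V_def)
  \<comment> \<open>Convexity in the radius is only available away from \<open>K\<close>. If, say, \<open>V y > m\<close>, then \<open>y\<close> may be
    close to \<open>K\<close>, but then moving \<open>y\<close> alone suffices and no convexity at \<open>y\<close> is needed.\<close>
  consider "m < V y" | "m < V z" | "V y = m" "V z = m" using m1 by linarith
  then show False
  proof cases
    case 1
    then obtain r where r: "r > 0" "r \<le> \<epsilon>" "m \<le> supball e (\<epsilon> - r) y" using small by blast
    have "l * r \<le> 1 * \<epsilon>" using r l by (intro mult_mono) auto
    then show False
      using r l \<epsilon> m1 mono[of y r] mono[of z 0] by (intro key[of "l * r" r 0 0]) (auto simp: V_def)
  next
    case 2
    then obtain s where s: "s > 0" "s \<le> \<epsilon>" "m \<le> supball e (\<epsilon> - s) z" using small by blast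
    have "(1 - l) * s \<le> 1 * \<epsilon>" using s l by (intro mult_mono) auto
    then show False
      using s l \<epsilon> m1 mono[of z s] mono[of y 0] by (intro key[of "(1 - l) * s" 0 s 0]) (auto simp: V_def)
  next
    case 3
    \<comment> \<open>A level near 1 puts both \<open>y\<close> and \<open>z\<close> close to
      \<open>K\<close>; by convexity of \<open>K\<close> then \<open>x\<close> is close to
      \<open>K\<close> too, which \<open>farK\<close> excludes.\<close>
    have nearK: False if "1 - \<eta> < m"
    proof -
      have "\<exists>k\<in>K. dist v k \<le> \<tau> + \<epsilon>" if "m \<le> V v" for v
      proof -
        obtain q where q: "dist v q \<le> \<epsilon>" "V v = e q"
          using supball_attained[OF c, of \<epsilon> v] \<epsilon> unfolding V_def by (metis less_imp_le)
        have "1 - \<eta>1 \<le> e q" using q that \<open>1 - \<eta> < m\<close> by (simp add: \<eta>_def)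
        then obtain k where "k \<in> K" "dist q k \<le> \<tau>" using \<eta>1 by blast
        then show ?thesis using q(1) dist_triangle[of v k q] by force
      qed
      then obtain k k' where k: "k \<in> K" "dist y k \<le> \<tau> + \<epsilon>" "k' \<in> K" "dist z k' \<le> \<tau> + \<epsilon>"
        using m1 by meson
      have "dist x (X k k') \<le> \<tau> + \<epsilon>"
        using convex_comb_dist[OF l01 k(2,4)] by (simp add: x_def X_def algebra_simps)
      moreover have "X k k' \<in> K" unfolding X_def using K(2) k l by (intro convexD) auto
      ultimately show False using farK[of "X k k'" "\<tau> + \<epsilon>"] \<tau> \<epsilon> by auto
    qed
    have ball: "cball v (2 * \<epsilon>) \<subseteq> \<Omega> - K" if "V v = m" for v
    proof -
      have "k \<notin> K" if "dist v k \<le> 2 * \<epsilon>" for k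
      proof
        assume "k \<in> K"
        have "dist v k < d2" using that \<epsilon> by simp
        then have "e v > 1 - \<eta>" using d2(2)[of v k] eK[OF \<open>k \<in> K\<close>] by linarith
        then show False using nearK Ve[of v] \<open>V v = m\<close> by simp
      qed
      then show ?thesis using inO[of v] that by auto
    qed
    have mid': "2 * m \<le> supball e (\<epsilon> - r) v + supball e (\<epsilon> + r) v"
      if "V v = m" "0 \<le> r" "r \<le> \<epsilon>" for v r
    proof -
      have "cball v (\<epsilon> + r) \<subseteq> cball v (2 * \<epsilon>)" using that by (intro subset_cball) simp
      then show ?thesis using mid[of v \<epsilon> r] ball[OF that(1)] that by (auto simp: V_def)
    qed
    \<comment> \<open>Small enough that moving \<open>y\<close> alone by
      \<open>\<delta> / l\<close>, or \<open>z\<close> alone by \<open>\<delta> / (1 - l)\<close>,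
      stays within \<epsilon>.\<close>
    define \<delta> where "\<delta> = min l (1 - l) * \<epsilon>"
    have \<delta>: "0 < \<delta>" "\<delta> \<le> l * \<epsilon>" "\<delta> \<le> (1 - l) * \<epsilon>"
      using l \<epsilon> by (auto simp: \<delta>_def min_def)
    have "l * \<epsilon> \<le> 1 * \<epsilon>" using l \<epsilon> by (intro mult_right_mono) auto
    then have \<delta>\<epsilon>: "\<delta> \<le> \<epsilon>" using \<delta> by simp
    define s where "s r = (\<delta> - l * r) / (1 - l)" for r
    have sr: "0 \<le> s r" "s r \<le> \<epsilon>" "r \<le> \<epsilon>" if "0 \<le> r" "r \<le> \<delta> / l" for r
    proof -
      have "l * r \<le> \<delta>" using that l by (simp add: field_simps)
      then show "0 \<le> s r" using l by (simp add: s_def)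
      have "0 \<le> l * r" using that l by simp
      then show "s r \<le> \<epsilon>" using l \<delta> by (simp add: s_def field_simps)
      have "\<delta> / l \<le> \<epsilon>" using l \<delta> by (simp add: field_simps)
      then show "r \<le> \<epsilon>" using that by simp
    qed
    \<comment> \<open>The difference of the two drops of \<open>V\<close>. At \<open>r = 0\<close>
      only \<open>z\<close> can drop and at \<open>r = \<delta> / l\<close> only \<open>y\<close>,
      so the intermediate value theorem yields equal drops.\<close>
    define \<psi> where "\<psi> r = supball e (\<epsilon> - s r) z - supball e (\<epsilon> - r) y" for r
    have "continuous_on {0..\<delta> / l} \<psi>"
      unfolding \<psi>_def s_def
      by (intro continuous_intros continuous_on_supball_compose uc) (use sr l in \<open>auto simp: s_def\<close>)
    moreover have "\<psi> 0 \<le> 0" "0 \<le> \<psi> (\<delta> / l)"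
    proof -
      have "0 \<le> \<delta> / l" using l \<delta> by simp
      then have "supball e (\<epsilon> - s 0) z \<le> V z" "supball e (\<epsilon> - \<delta> / l) y \<le> V y"
        unfolding V_def using sr[of 0] sr[of "\<delta> / l"] by (intro supball_mono[OF c]; simp)+
      moreover have "s (\<delta> / l) = 0" using l by (simp add: s_def)
      ultimately show "\<psi> 0 \<le> 0" "0 \<le> \<psi> (\<delta> / l)" using 3 by (simp_all add: \<psi>_def V_def)
    qed
    moreover have "0 \<le> \<delta> / l" using l \<delta> by simp
    ultimately obtain r where r: "0 \<le> r" "r \<le> \<delta> / l" "\<psi> r = 0"
      using IVT'[of \<psi> 0 0 "\<delta> / l"] by blast
    define k' where "k' = m - supball e (\<epsilon> - r) y"
    have eq: "supball e (\<epsilon> - r) y = m - k'" "supball e (\<epsilon> - s r) z = m - k'"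
      using r(3) by (simp_all add: k'_def \<psi>_def)
    have "supball e (\<epsilon> - r) y \<le> V y"
      unfolding V_def using sr[OF r(1,2)] r(1) by (intro supball_mono[OF c]) auto
    then have "0 \<le> k'" using 3 by (simp add: k'_def)
    moreover have "m + k' \<le> supball e (\<epsilon> + r) y" "m + k' \<le> supball e (\<epsilon> + s r) z"
      using mid'[OF 3(1), of r] mid'[OF 3(2), of "s r"] eq sr[OF r(1,2)] r(1) by simp_all
    moreover have "l * r + (1 - l) * s r = \<delta>" using l by (simp add: s_def)
    ultimately show False
      using key[OF \<delta>(1) \<delta>\<epsilon>, of r "s r" k'] sr[OF r(1,2)] r(1) eq by simp
  qed
qed

section \<open>Potentials of convex rings\<close>

lemma inf_subharmonic_cong:
  assumes "inf_subharmonic_viscosity G u" "\<And>x. x \<in> G \<Longrightarrow> u x = v x"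
  shows "inf_subharmonic_viscosity G v"
  using assms unfolding inf_subharmonic_viscosity_def by (metis subset_iff)

lemma inf_subharmonic_max_principle:
  fixes u :: "real^'n::finite \<Rightarrow> real"
  assumes sub: "inf_subharmonic_viscosity G u" and "open G" "bounded G" "continuous_on (closure G) u"
    and bd: "\<And>x. x \<in> closure G - G \<Longrightarrow> u x \<le> c" and "x \<in> closure G"
  shows "u x \<le> c"
proof (rule ccontr)
  assume neg: "\<not> ?thesis"
  obtain p where p: "p \<notin> G" using \<open>bounded G\<close> not_bounded_UNIV by (metis UNIV_I subset_iff bounded_subset)
  \<comment> \<open>A slope so small that a cone with vertex outside \<open>G\<close> rises by less
    than the excess \<open>u x - c\<close> at \<open>x\<close>.\<close>
  define b where "b = (u x - c) / (2 * (norm (x - p) + 1))"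
  have pos: "norm (x - p) + 1 > 0" by (simp add: add_nonneg_pos)
  have b: "b > 0" using neg pos by (simp add: b_def)
  have "u x \<le> c + b * norm (x - p)"
  proof (rule inf_subharmonic_le_cone[OF sub])
    show "u z \<le> c + b * norm (z - p)" if "z \<in> closure G - G" for z
      using bd[OF that] b by (simp add: add_increasing2)
  qed (use assms p b closure_subset in \<open>auto simp: compact_closure\<close>)
  also have "\<dots> < c + b * (2 * (norm (x - p) + 1))"
    using b by (intro add_strict_left_mono mult_strict_left_mono) (auto simp: add_nonneg_pos)
  also have "\<dots> = u x" using pos by (simp add: b_def)
  finally show False by simp
qed

text \<open>Comparison with the cone about \<open>y\<close> that equals \<open>A\<close> and
  \<open>B\<close> on the two spheres. Its slope may be zero while cone comparison asks for a
  positive one, so larger slopes are used and then sent to the limit. For \<open>r1 = 0\<close> the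
  inner sphere is the point \<open>y\<close>.\<close>

lemma inf_subharmonic_annulus:
  fixes u :: "real^'n::finite \<Rightarrow> real"
  assumes sub: "inf_subharmonic_viscosity G u" and cont: "continuous_on G u"
    and "cball y r2 \<subseteq> G" "0 \<le> r1" "r1 < r2" "A \<le> B"
    and A: "\<And>x. dist y x = r1 \<Longrightarrow> u x \<le> A" and B: "\<And>x. dist y x = r2 \<Longrightarrow> u x \<le> B"
    and x: "r1 \<le> dist y x" "dist y x \<le> r2"
  shows "u x \<le> A + (B - A) / (r2 - r1) * (dist y x - r1)"
proof -
  define b0 where "b0 = (B - A) / (r2 - r1)"
  have b0: "b0 \<ge> 0" using assms by (simp add: b0_def)
  have b0B: "A + b0 * (r2 - r1) = B" using \<open>r1 < r2\<close> by (simp add: b0_def)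
  have le: "u x \<le> A + b * (dist y x - r1)" if "b > b0" for b
  proof -
    have "u x \<le> (A - b * r1) + b * norm (x - y)"
    proof (rule inf_subharmonic_le_cone[OF sub, where C = "cball y r2 - ball y r1"
          and U = "ball y r2 - cball y r1"])
      show "compact (cball y r2 - ball y r1)" by (simp add: compact_diff)
      show "continuous_on (cball y r2 - ball y r1) u"
        by (rule continuous_on_subset[OF cont]) (use assms in auto)
      show "open (ball y r2 - cball y r1)" by (simp add: open_Diff)
      show "ball y r2 - cball y r1 \<subseteq> G" using assms(3) by auto
      show "ball y r2 - cball y r1 \<subseteq> cball y r2 - ball y r1" by auto
      show "y \<notin> ball y r2 - cball y r1" using assms by simp
      show "b > 0" using that b0 by simp
      show "x \<in> cball y r2 - ball y r1" using x by auto
      fix z assume "z \<in> (cball y r2 - ball y r1) - (ball y r2 - cball y r1)"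
      then consider "dist y z = r1" | "dist y z = r2" by force
      then show "u z \<le> (A - b * r1) + b * norm (z - y)"
      proof cases
        case 1
        then show ?thesis using A[OF 1] by (simp add: dist_norm norm_minus_commute)
      next
        case 2
        have "B \<le> A + b * (r2 - r1)"
          unfolding b0B[symmetric] using that assms by (intro add_left_mono mult_right_mono) auto
        then show ?thesis
          using B[OF 2] 2 by (simp add: dist_norm norm_minus_commute algebra_simps)
      qed
    qed
    then show ?thesis by (simp add: dist_norm norm_minus_commute algebra_simps)
  qed
  have "u x \<le> (A + b0 * (dist y x - r1)) + t" if "t > 0" for t
  proof -
    \<comment> \<open>The denominator makes the additional slope cost at most \<open>t\<close> at
      \<open>x\<close>.\<close>
    define b where "b = b0 + t / (dist y x - r1 + 1)"
    have pos: "dist y x - r1 + 1 > 0" using x by simp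
    have "u x \<le> A + b * (dist y x - r1)" by (rule le) (use that pos in \<open>simp add: b_def\<close>)
    also have "b * (dist y x - r1) = b0 * (dist y x - r1) + t * ((dist y x - r1) / (dist y x - r1 + 1))"
      by (simp add: b_def distrib_right)
    also have "(dist y x - r1) / (dist y x - r1 + 1) \<le> 1" using pos by simp
    finally show ?thesis using that by (simp add: mult_left_mono algebra_simps)
  qed
  then show ?thesis unfolding b0_def[symmetric] by (rule field_le_epsilon)
qed

text \<open>Midpoint convexity of the maximum in the radius: the cone interpolating between radii
  \<open>r - s\<close> and \<open>r + s\<close> has the average value at radius
  \<open>r\<close>.\<close>

lemma inf_subharmonic_supball_midpoint:
  fixes f :: "real^'n::finite \<Rightarrow> real"
  assumes sub: "inf_subharmonic_viscosity G f" and cont: "continuous_on UNIV f"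
    and "cball y (r + s) \<subseteq> G" "0 \<le> s" "s \<le> r"
  shows "2 * supball f r y \<le> supball f (r - s) y + supball f (r + s) y"
proof (cases "s = 0")
  case False
  define A B where "A = supball f (r - s) y" and "B = supball f (r + s) y"
  have AB: "A \<le> B" unfolding A_def B_def using assms by (intro supball_mono) auto
  have "f x \<le> (A + B) / 2" if "dist y x \<le> r" for x
  proof (cases "dist y x \<le> r - s")
    case True
    then have "f x \<le> A" unfolding A_def by (rule le_supball[OF cont])
    then show ?thesis using AB by simp
  next
    case False
    have "f x \<le> A + (B - A) / ((r + s) - (r - s)) * (dist y x - (r - s))"
    proof (rule inf_subharmonic_annulus[OF sub])
      show "continuous_on G f" using cont by (rule continuous_on_subset) simp
      show "f z \<le> A" if "dist y z = r - s" for z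
        unfolding A_def using that by (intro le_supball[OF cont]) simp
      show "f z \<le> B" if "dist y z = r + s" for z
        unfolding B_def using that by (intro le_supball[OF cont]) simp
    qed (use assms AB False \<open>s \<noteq> 0\<close> that in auto)
    also have "\<dots> \<le> A + (B - A) / ((r + s) - (r - s)) * s"
      using AB that assms by (intro add_left_mono mult_left_mono) auto
    also have "\<dots> = (A + B) / 2" using \<open>s \<noteq> 0\<close> by (simp add: field_simps)
    finally show ?thesis .
  qed
  then have "supball f r y \<le> (A + B) / 2"
    using supball_le_iff[OF cont, of r y "(A + B) / 2"] assms by simp
  then show ?thesis by (simp add: A_def B_def)
qed simp

section \<open>The extended potential and its convex superlevel sets\<close>

locale convex_ring_potential =
  fixes \<Omega> K :: "(real^'n::finite) set" and u :: "real^'n \<Rightarrow> real"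
  assumes \<Omega>: "open \<Omega>" "bounded \<Omega>" "convex \<Omega>"
    and K: "compact K" "convex K" "K \<noteq> {}" "K \<subseteq> \<Omega>"
    and cont_u: "continuous_on (closure (\<Omega> - K)) u"
    and harmonic: "inf_harmonic_viscosity (\<Omega> - K) u"
    and outer: "\<And>x. x \<in> frontier \<Omega> \<Longrightarrow> u x = 0"
    and inner: "\<And>x. x \<in> frontier K \<Longrightarrow> u x = 1"
begin

definition ext :: "real^'n \<Rightarrow> real" where
  "ext x = (if x \<in> K then 1 else if x \<in> \<Omega> then u x else 0)"

lemma open_ring: "open (\<Omega> - K)"
  using \<Omega> K by (simp add: open_Diff compact_imp_closed)

lemma closure_ring:
  assumes "x \<in> closure (\<Omega> - K)"
  obtains "x \<in> \<Omega> - K" | "x \<in> frontier \<Omega>" "x \<notin> \<Omega>" | "x \<in> frontier K" "x \<in> K"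
proof -
  have 1: "x \<in> closure \<Omega>" "x \<in> closure (- K)"
    using assms closure_mono[of "\<Omega> - K" \<Omega>] closure_mono[of "\<Omega> - K" "- K"] by auto
  show ?thesis
  proof (cases "x \<in> \<Omega>")
    case False
    then show ?thesis using that(2) 1 \<Omega>(1) by (simp add: frontier_def interior_open)
  next
    case True
    then show ?thesis using that(1,3) 1(2) closure_subset[of K] by (auto simp: frontier_closures)
  qed
qed

lemma ext_eq:
  assumes "x \<in> closure (\<Omega> - K)"
  shows "ext x = u x"
  using assms by (rule closure_ring) (use outer inner K in \<open>auto simp: ext_def\<close>)

lemma ext_outside: "x \<notin> \<Omega> \<Longrightarrow> ext x = 0"
  using K by (auto simp: ext_def)

lemma ext_inside: "x \<in> K \<Longrightarrow> ext x = 1"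
  by (simp add: ext_def)

lemma continuous_ext: "continuous_on UNIV ext"
proof -
  have "continuous_on (K \<union> (closure (\<Omega> - K) \<union> - \<Omega>)) ext"
  proof (intro continuous_on_closed_Un)
    show "continuous_on K ext" by (simp add: ext_inside cong: continuous_on_cong)
    show "continuous_on (closure (\<Omega> - K)) ext" using cont_u by (simp add: ext_eq cong: continuous_on_cong)
    show "continuous_on (- \<Omega>) ext"
      by (rule continuous_on_eq[of _ "\<lambda>_. 0"]) (auto simp: ext_outside)
  qed (use \<Omega> K in \<open>auto simp: compact_imp_closed\<close>)
  moreover have "K \<union> (closure (\<Omega> - K) \<union> - \<Omega>) = UNIV"
    using closure_subset[of "\<Omega> - K"] by auto
  ultimately show ?thesis by simp
qed

lemma uniformly_continuous_ext: "uniformly_continuous_on UNIV ext"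
  unfolding uniformly_continuous_on_def
proof (intro allI impI)
  fix e :: real assume "e > 0"
  obtain R where R: "\<And>x. x \<in> \<Omega> \<Longrightarrow> norm x \<le> R" using \<Omega>(2) by (auto simp: bounded_iff)
  \<comment> \<open>A margin of 1 suffices: of two points at distance below 1, if one leaves this
    ball then both lie outside \<Omega>, where \<open>ext\<close> vanishes.\<close>
  have "uniformly_continuous_on (cball 0 (R + 1)) ext"
    by (intro compact_uniformly_continuous continuous_on_subset[OF continuous_ext]) auto
  then obtain d where d: "d > 0"
    "\<And>x x'. \<lbrakk>norm x \<le> R + 1; norm x' \<le> R + 1; dist x' x < d\<rbrakk> \<Longrightarrow> dist (ext x') (ext x) < e"
    using \<open>e > 0\<close> unfolding uniformly_continuous_on_def by (auto simp: Ball_def)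
  have "dist (ext x') (ext x) < e" if "dist x' x < min d 1" for x x'
  proof (cases "norm x \<le> R + 1 \<and> norm x' \<le> R + 1")
    case True
    then show ?thesis using d that by simp
  next
    case False
    moreover have "norm x - norm x' < 1" "norm x' - norm x < 1"
      using that norm_triangle_ineq2[of x x'] norm_triangle_ineq2[of x' x]
      by (auto simp: dist_norm norm_minus_commute)
    ultimately have "norm x > R" "norm x' > R" by auto
    then have "x \<notin> \<Omega>" "x' \<notin> \<Omega>" using R by force+
    then show ?thesis using \<open>e > 0\<close> by (simp add: ext_outside)
  qed
  then show "\<exists>d>0. \<forall>x\<in>UNIV. \<forall>x'\<in>UNIV. dist x' x < d \<longrightarrow> dist (ext x') (ext x) < e"
    using d(1) by (intro exI[of _ "min d 1"]) auto
qed

lemma ext_sub: "inf_subharmonic_viscosity (\<Omega> - K) ext"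
  using harmonic closure_subset[of "\<Omega> - K"] unfolding inf_harmonic_viscosity_def
  by (auto intro: inf_subharmonic_cong simp: ext_eq subset_iff)

lemma neg_ext_sub: "inf_subharmonic_viscosity (\<Omega> - K) (\<lambda>x. - ext x)"
  by (rule inf_subharmonic_cong[OF inf_subharmonic_uminus[of _ u]])
    (use harmonic closure_subset[of "\<Omega> - K"] in \<open>auto simp: inf_harmonic_viscosity_def ext_eq subset_iff\<close>)

lemma ext_bounds: "0 \<le> ext x" "ext x \<le> 1"
proof -
  have bd: "ext z = 0 \<or> ext z = 1" if "z \<in> closure (\<Omega> - K) - (\<Omega> - K)" for z
    using that ext_outside[of z] ext_inside[of z] by auto
  have bdd: "bounded (\<Omega> - K)" using \<Omega> by (simp add: bounded_diff)
  have "ext x \<le> 1 \<and> - ext x \<le> 0" if "x \<in> \<Omega> - K"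
    using that bd closure_subset[of "\<Omega> - K"]
      inf_subharmonic_max_principle[OF ext_sub open_ring bdd continuous_on_subset[OF continuous_ext], of 1 x]
      inf_subharmonic_max_principle[OF neg_ext_sub open_ring bdd
        continuous_on_minus[OF continuous_on_subset[OF continuous_ext]], of 0 x]
    by fastforce
  then show "0 \<le> ext x" "ext x \<le> 1"
    by (cases "x \<in> K"; cases "x \<in> \<Omega>"; simp add: ext_inside ext_outside)+
qed

lemma ext_cone:
  assumes "cball x d \<subseteq> \<Omega> - K" "0 < d" "\<And>z. dist x z = d \<Longrightarrow> ext z \<le> c" "ext x \<le> c" "dist x z \<le> d"
  shows "ext z \<le> ext x + (c - ext x) / d * dist x z"
  using inf_subharmonic_annulus[OF ext_sub continuous_on_subset[OF continuous_ext], of x d 0 "ext x" c z] assms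
  by auto

text \<open>Strong maximum principle: at a point of \<open>{x. 1 \<le> ext x}\<close> farthest from
  \<open>K\<close>, cone comparison would make that set a neighbourhood, and stepping away from
  \<open>K\<close> would increase the distance.\<close>

lemma ext_less:
  assumes "x0 \<notin> K"
  shows "ext x0 < 1"
proof (rule ccontr)
  assume neg: "\<not> ?thesis"
  define A where "A = {x. 1 \<le> ext x}"
  have "closed A" unfolding A_def by (intro closed_Collect_le continuous_ext continuous_intros)
  moreover have "A \<subseteq> \<Omega>" using ext_outside by (force simp: A_def)
  ultimately have "compact A" using \<Omega>(2) bounded_subset compact_eq_bounded_closed by blast
  moreover have "x0 \<in> A" using neg by (simp add: A_def)
  moreover have "continuous_on A (\<lambda>x. infdist x K)" by (intro continuous_intros)
  ultimately obtain x where x: "x \<in> A" "\<forall>z\<in>A. infdist z K \<le> infdist x K"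
    using continuous_attains_sup[of A "\<lambda>x. infdist x K"] by blast
  have cK: "closed K" using K by (simp add: compact_imp_closed)
  have "infdist x0 K > 0" using assms cK K by (simp add: infdist_pos_not_in_closed)
  then have "infdist x K > 0" using x(2) \<open>x0 \<in> A\<close> by fastforce
  then have "x \<notin> K" by auto
  then have "x \<in> \<Omega> - K" using x(1) \<open>A \<subseteq> \<Omega>\<close> by auto
  then obtain r where r: "r > 0" "cball x r \<subseteq> \<Omega> - K"
    using open_ring open_contains_cball by blast
  \<comment> \<open>The cone is centred at \<open>p\<close>, not at \<open>x\<close>: a deficit of
    \<open>ext\<close> at \<open>p\<close> would persist at \<open>x\<close>, strictly inside the
    ball of radius \<open>r / 2\<close> about \<open>p\<close>.\<close>
  have near: "p \<in> A" if "dist p x < r / 2" for p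
  proof -
    have "cball p (r / 2) \<subseteq> cball x r"
    proof
      fix q assume "q \<in> cball p (r / 2)"
      then show "q \<in> cball x r" using that dist_triangle[of x q p] by (simp add: dist_commute)
    qed
    then have "ext x \<le> ext p + (1 - ext p) / (r / 2) * dist p x"
      using ext_bounds r that by (intro ext_cone) auto
    then have "1 \<le> ext p + (1 - ext p) / (r / 2) * dist p x"
      using x(1) by (simp add: A_def)
    then have "(1 - ext p) * (1 - dist p x / (r / 2)) \<le> 0"
      by (simp add: algebra_simps)
    moreover have "1 - dist p x / (r / 2) > 0" using that r by simp
    ultimately show ?thesis using ext_bounds(2)[of p] by (simp add: A_def mult_le_0_iff)
  qed
  define k where "k = closest_point K x"
  have kK: "k \<in> K" using cK K by (simp add: k_def closest_point_in_set)
  have xk: "x \<noteq> k" using kK \<open>x \<notin> K\<close> by auto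
  then have nk: "norm (x - k) > 0" by simp
  define t where "t = r / (4 * norm (x - k))"
  have t: "t > 0" using r nk by (simp add: t_def)
  \<comment> \<open>A step along the outer normal at the projection \<open>k\<close>; the supporting
    half-space of \<open>K\<close> at \<open>k\<close> shows that the distance to \<open>K\<close>
    grows by the factor \<open>1 + t\<close>.\<close>
  define p where "p = x + t *\<^sub>R (x - k)"
  have "dist p x = r / 4" using r nk by (simp add: p_def dist_norm t_def)
  then have "p \<in> A" using near r by simp
  obtain k' where k': "k' \<in> K" "infdist p K = dist p k'"
    using infdist_attains_inf[OF cK K(3)] by blast
  have "(x - k) \<bullet> (k' - k) \<le> 0"
    unfolding k_def by (rule closest_point_dot[OF K(2) cK k'(1)])
  then have "(1 + t) * (norm (x - k))\<^sup>2 \<le> (x - k) \<bullet> (p - k')"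
  proof -
    have "p - k' = (1 + t) *\<^sub>R (x - k) - (k' - k)" by (simp add: p_def algebra_simps)
    then have "(x - k) \<bullet> (p - k') = (1 + t) * ((x - k) \<bullet> (x - k)) - (x - k) \<bullet> (k' - k)"
      by (simp only: inner_diff_right[of "x - k" "(1 + t) *\<^sub>R (x - k)"] inner_scaleR_right)
    then show ?thesis using \<open>(x - k) \<bullet> (k' - k) \<le> 0\<close> by (simp add: power2_norm_eq_inner)
  qed
  also have "\<dots> \<le> norm (x - k) * norm (p - k')" by (rule norm_cauchy_schwarz)
  finally have "(1 + t) * norm (x - k) \<le> norm (p - k')"
    using nk by (simp add: power2_eq_square mult_ac)
  moreover have "norm (x - k) < (1 + t) * norm (x - k)" using t nk by simp
  moreover have "infdist x K \<le> norm (x - k)" using infdist_le[OF kK, of x] by (simp add: dist_norm)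
  ultimately have "infdist x K < infdist p K" using k' by (simp add: dist_norm)
  then show False using x(2) \<open>p \<in> A\<close> by fastforce
qed

lemma ext_quasiconcave:
  assumes "0 \<le> l" "l \<le> 1"
  shows "min (ext y) (ext z) \<le> ext (l *\<^sub>R y + (1 - l) *\<^sub>R z)"
proof (rule quasiconcave_of_supball_convex[OF uniformly_continuous_ext \<Omega>(2,3) K ext_bounds ext_outside
      ext_inside ext_less _ _ assms])
  show "2 * supball ext r y \<le> supball ext (r - s) y + supball ext (r + s) y"
    if "cball y (r + s) \<subseteq> \<Omega> - K" "0 \<le> s" "s \<le> r" for y r s
    by (rule inf_subharmonic_supball_midpoint[OF ext_sub continuous_ext that])
  show "2 * supball (\<lambda>x. - ext x) r y \<le> supball (\<lambda>x. - ext x) (r - s) y + supball (\<lambda>x. - ext x) (r + s) y"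
    if "cball y (r + s) \<subseteq> \<Omega> - K" "0 \<le> s" "s \<le> r" for y r s
    by (rule inf_subharmonic_supball_midpoint[OF neg_ext_sub _ that])
      (intro continuous_on_minus continuous_ext)
qed

lemma superlevel_convex: "convex {x. c \<le> ext x}"
proof (rule convexI)
  fix y z and l m :: real
  assume *: "y \<in> {x. c \<le> ext x}" "z \<in> {x. c \<le> ext x}" "0 \<le> l" "0 \<le> m" "l + m = 1"
  then have m: "m = 1 - l" by simp
  show "l *\<^sub>R y + m *\<^sub>R z \<in> {x. c \<le> ext x}"
    using ext_quasiconcave[of l y z] * by (simp add: m)
qed

lemma superlevel_closed: "closed {x. c \<le> ext x}"
  by (intro closed_Collect_le continuous_ext continuous_intros)

end

section \<open>Streamlines\<close>

text \<open>Otherwise \<open>f (x + s *\<^sub>R v) - s * S\<close> would increase strictly to the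
  right of \<open>s = 0\<close>. It extracts gradient bounds from cone estimates known only on one
  side.\<close>

lemma derivative_le_of_increment_le:
  fixes f :: "'a::real_normed_vector \<Rightarrow> real"
  assumes f: "(f has_derivative f') (at x)" and "d > 0"
    and le: "\<And>s. 0 < s \<Longrightarrow> s < d \<Longrightarrow> f (x + s *\<^sub>R v) \<le> f x + s * S"
  shows "f' v \<le> S"
proof (rule ccontr)
  assume neg: "\<not> ?thesis"
  have lin: "linear f'" using f by (rule has_derivative_linear)
  have "((\<lambda>s. x + s *\<^sub>R v) has_derivative (\<lambda>s. s *\<^sub>R v)) (at 0)"
    by (auto intro!: derivative_eq_intros)
  moreover have "(f has_derivative f') (at (x + 0 *\<^sub>R v))" using f by simp
  ultimately have "((\<lambda>s. f (x + s *\<^sub>R v)) has_derivative (\<lambda>s. f' (s *\<^sub>R v))) (at 0)"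
    by (rule has_derivative_compose)
  then have "((\<lambda>s. f (x + s *\<^sub>R v)) has_real_derivative f' v) (at 0)"
    by (rule has_derivative_imp_has_field_derivative) (simp add: linear_scale[OF lin])
  then have "((\<lambda>s. f (x + s *\<^sub>R v) - s * S) has_real_derivative f' v - S) (at 0)"
    by (auto intro!: derivative_eq_intros)
  moreover have "f' v - S > 0" using neg by simp
  ultimately have "\<exists>r>0. \<forall>h>0. h < r \<longrightarrow> f (x + 0 *\<^sub>R v) - 0 * S < f (x + (0 + h) *\<^sub>R v) - (0 + h) * S"
    by (rule DERIV_pos_inc_right)
  then obtain r where r: "r > 0" "\<And>h. \<lbrakk>h > 0; h < r\<rbrakk> \<Longrightarrow> f x < f (x + h *\<^sub>R v) - h * S"
    by auto
  define h where "h = min r d / 2"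
  have "h > 0" "h < r" "h < d" using r(1) \<open>d > 0\<close> by (auto simp: h_def)
  then show False using r(2)[of h] le[of h] by simp
qed

text \<open>The mean value theorem on both sides of an intermediate point compares the chord slopes.
  Derivatives are asked for only in the open interval, since the streamline ends on
  \<open>K\<close>.\<close>

lemma convex_on_mono_derivative:
  fixes f f' :: "real \<Rightarrow> real"
  assumes cont: "continuous_on {a..b} f"
    and deriv: "\<And>x. a < x \<Longrightarrow> x < b \<Longrightarrow> (f has_real_derivative f' x) (at x)"
    and mono: "\<And>x y. a < x \<Longrightarrow> x \<le> y \<Longrightarrow> y < b \<Longrightarrow> f' x \<le> f' y"
  shows "convex_on {a..b} f"
proof (rule convex_on_linorderI)
  fix t x y :: real
  assume t: "0 < t" "t < 1" and x: "x \<in> {a..b}" and y: "y \<in> {a..b}" and "x < y"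
  define z where "z = (1 - t) *\<^sub>R x + t *\<^sub>R y"
  have zx: "z - x = t * (y - x)" and yz: "y - z = (1 - t) * (y - x)"
    by (simp_all add: z_def algebra_simps)
  then have z: "x < z" "z < y" using t \<open>x < y\<close> by (metis diff_gt_0_iff_gt mult_pos_pos)+
  have sub: "{x..z} \<subseteq> {a..b}" "{z..y} \<subseteq> {a..b}" using x y z by auto
  obtain p where p: "x < p" "p < z" "f z - f x = f' p * (z - x)"
    by (rule mvt[OF z(1) continuous_on_subset[OF cont sub(1)], of "\<lambda>p. (*) (f' p)"])
      (use x y z deriv in \<open>auto simp: has_field_derivative_def\<close>)
  obtain q where q: "z < q" "q < y" "f y - f z = f' q * (y - z)"
    by (rule mvt[OF z(2) continuous_on_subset[OF cont sub(2)], of "\<lambda>p. (*) (f' p)"])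
      (use x y z deriv in \<open>auto simp: has_field_derivative_def\<close>)
  have "f' p \<le> f' q" using mono[of p q] p q x y by auto
  then have "((1 - t) * t * (y - x)) * f' p \<le> ((1 - t) * t * (y - x)) * f' q"
    using t \<open>x < y\<close> by (intro mult_left_mono) auto
  then have "(1 - t) * (f z - f x) \<le> t * (f y - f z)"
    unfolding p(3) q(3) zx yz by (simp add: mult_ac)
  then show "f ((1 - t) *\<^sub>R x + t *\<^sub>R y) \<le> (1 - t) * f x + t * f y"
    unfolding z_def[symmetric] by (simp add: algebra_simps)
qed (rule convex_real_interval)

section \<open>Gradients under projection and along streamlines\<close>

locale smooth_convex_ring_potential = convex_ring_potential \<Omega> K u
  for \<Omega> K :: "(real^'n::finite) set" and u :: "real^'n \<Rightarrow> real" +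
  fixes g :: "real^'n \<Rightarrow> real^'n"
  assumes grad: "\<And>x. x \<in> \<Omega> - K \<Longrightarrow> GDERIV u x :> g x"
    and cont_g: "continuous_on (closure \<Omega> - K) g"
begin

lemma has_derivative_ext:
  assumes "x \<in> \<Omega> - K"
  shows "(ext has_derivative (\<lambda>h. h \<bullet> g x)) (at x)"
  by (rule has_derivative_transform_within_open[OF grad[OF assms, unfolded gderiv_def] open_ring assms])
    (simp add: ext_def)

text \<open>The slope \<open>S\<close> of the cone with vertex \<open>x\<close> that reaches level
  \<open>c\<close> on the sphere through \<open>y\<close> separates the two norms:
  \<open>ext\<close> rises from \<open>x\<close> at rate at most \<open>S\<close>, and since the
  cone touches it from above at \<open>y\<close>, it falls from \<open>y\<close> towards
  \<open>x\<close> at rate at least \<open>S\<close>.\<close>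

lemma norm_grad_le_closest_point:
  assumes x: "x \<in> \<Omega> - K" and ball: "cball x (dist x y) \<subseteq> \<Omega> - K" and cy: "c \<le> ext y"
    and closest: "\<And>z. c \<le> ext z \<Longrightarrow> dist x y \<le> dist x z"
  shows "norm (g x) \<le> norm (g y)"
proof (cases "x = y")
  case False
  define d where "d = dist x y"
  have d: "d > 0" using False by (simp add: d_def)
  have lt: "ext z < c" if "dist x z < d" for z
    using closest[of z] that by (force simp: d_def)
  \<comment> \<open>Minimality of the distance controls the open ball only; continuity adds the
    sphere.\<close>
  have le: "ext z \<le> c" if "dist x z \<le> d" for z
  proof (rule continuous_le_on_closure[of "ball x d" ext])
    show "continuous_on (closure (ball x d)) ext"
      using continuous_ext by (rule continuous_on_subset) simp
    show "z \<in> closure (ball x d)" using that d by simp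
  qed (use lt in \<open>auto simp: less_imp_le\<close>)
  have eqy: "ext y = c" using le[of y] cy by (simp add: d_def)
  define S where "S = (c - ext x) / d"
  have S: "S > 0" using lt[of x] d by (simp add: S_def)
  have Sd: "S * d = c - ext x" using d by (simp add: S_def)
  have cone: "ext z \<le> ext x + S * dist x z" if "dist x z \<le> d" for z
    unfolding S_def using ball d le lt[of x] that by (intro ext_cone) (auto simp: d_def[symmetric])
  have "norm (g x) \<le> S"
  proof (cases "g x = 0")
    case False
    have "sgn (g x) \<bullet> g x \<le> S"
    proof (rule derivative_le_of_increment_le[OF has_derivative_ext[OF x] d])
      fix s assume "0 < s" "s < d"
      then show "ext (x + s *\<^sub>R sgn (g x)) \<le> ext x + s * S"
        using cone[of "x + s *\<^sub>R sgn (g x)"] False by (simp add: dist_norm norm_sgn mult.commute)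
    qed
    moreover have "sgn (g x) \<bullet> g x = norm (g x)"
      using False by (simp add: sgn_div_norm power2_norm_eq_inner[symmetric] power2_eq_square)
    ultimately show ?thesis by simp
  qed (use S in simp)
  also have "S \<le> norm (g y)"
  proof -
    define n where "n = sgn (y - x)"
    have nn: "norm n = 1" using False by (simp add: n_def norm_sgn)
    have yx: "y - x = d *\<^sub>R n"
      using False by (simp add: n_def d_def dist_norm sgn_div_norm norm_minus_commute)
    have y: "y \<in> \<Omega> - K" using ball by auto
    have "(- n) \<bullet> g y \<le> - S"
    proof (rule derivative_le_of_increment_le[OF has_derivative_ext[OF y] d])
      fix s assume s: "0 < s" "s < d"
      have "x - (y + s *\<^sub>R (- n)) = (s - d) *\<^sub>R n" using yx by (simp add: algebra_simps)
      then have "dist x (y + s *\<^sub>R (- n)) = d - s" using s nn by (simp add: dist_norm)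
      then have "ext (y + s *\<^sub>R (- n)) \<le> ext x + S * (d - s)"
        using cone[of "y + s *\<^sub>R (- n)"] s by simp
      also have "\<dots> = ext y + s * (- S)" using Sd eqy by (simp add: algebra_simps)
      finally show "ext (y + s *\<^sub>R (- n)) \<le> ext y + s * (- S)" .
    qed
    then have "S \<le> n \<bullet> g y" by simp
    also have "\<dots> \<le> norm n * norm (g y)" by (rule norm_cauchy_schwarz)
    finally show ?thesis using nn by simp
  qed
  finally show ?thesis .
qed simp

text \<open>With p the projection, (x - p).(q - p) is at most 0 by the obtuse angle property, and (q
  - p).g(q) is at most 0 because the segment from q to p stays in the convex superlevel set. Hence
  |q - p|^2 is at most (q - p).(q - x - h g(q)).\<close>

lemma dist_closest_point_euler_step:
  assumes q: "q \<in> \<Omega> - K" and "0 \<le> h" and err: "norm (q - x - h *\<^sub>R g q) \<le> e"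
  shows "dist (closest_point {z. ext q \<le> ext z} x) q \<le> e"
proof -
  define p where "p = closest_point {z. ext q \<le> ext z} x"
  have p: "ext q \<le> ext p"
    using closest_point_in_set[OF superlevel_closed[of "ext q"], of x] by (auto simp: p_def)
  have proj: "(x - p) \<bullet> (q - p) \<le> 0"
    unfolding p_def by (rule closest_point_dot[OF superlevel_convex superlevel_closed]) simp
  have "(q - p) \<bullet> g q \<le> 0"
  proof -
    have "(p - q) \<bullet> (- g q) \<le> 0"
    proof (rule derivative_le_of_increment_le[of "\<lambda>z. - ext z" "\<lambda>h. h \<bullet> (- g q)" q 1])
      show "((\<lambda>z. - ext z) has_derivative (\<lambda>h. h \<bullet> (- g q))) (at q)"
        using has_derivative_minus[OF has_derivative_ext[OF q]] by simp
      fix s :: real assume s: "0 < s" "s < 1"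
      have "q + s *\<^sub>R (p - q) = (1 - s) *\<^sub>R q + s *\<^sub>R p" by (simp add: algebra_simps)
      moreover have "(1 - s) *\<^sub>R q + s *\<^sub>R p \<in> {z. ext q \<le> ext z}"
        using p s by (intro convexD[OF superlevel_convex]) auto
      ultimately show "- ext (q + s *\<^sub>R (p - q)) \<le> - ext q + s * 0" by simp
    qed simp
    then show ?thesis by (simp add: inner_diff_left)
  qed
  then have "h * ((q - p) \<bullet> g q) \<le> 0" using \<open>0 \<le> h\<close> by (simp add: mult_nonneg_nonpos)
  then have "(norm (q - p))\<^sup>2 \<le> (q - p) \<bullet> (q - x - h *\<^sub>R g q)"
    using proj by (simp add: power2_norm_eq_inner inner_diff_left inner_diff_right inner_commute algebra_simps)
  also have "\<dots> \<le> norm (q - p) * norm (q - x - h *\<^sub>R g q)" by (rule norm_cauchy_schwarz)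
  also have "\<dots> \<le> norm (q - p) * e" using err by (rule mult_left_mono) simp
  finally have "norm (q - p) \<le> e \<or> q = p" by (cases "q = p") (auto simp: power2_eq_square)
  moreover have "0 \<le> e" using err norm_ge_zero order_trans by blast
  ultimately show ?thesis by (auto simp: p_def[symmetric] dist_norm norm_minus_commute)
qed

text \<open>Uniform continuity of the velocity makes the Euler error o(b - a) uniformly. The
  velocity is taken at the later time, as the projection estimate requires.\<close>

lemma streamline_uniform_euler:
  assumes in_ring: "\<And>\<tau>. \<tau> \<in> {s..t} \<Longrightarrow> \<alpha> \<tau> \<in> \<Omega> - K"
    and deriv: "\<And>\<tau>. \<tau> \<in> {s..t} \<Longrightarrow> (\<alpha> has_vector_derivative g (\<alpha> \<tau>)) (at \<tau> within {s..t})"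
    and "e > 0"
  obtains h0 where "h0 > 0" "\<And>a b. \<lbrakk>s \<le> a; a \<le> b; b \<le> t; b - a < h0\<rbrakk> \<Longrightarrow>
    norm (\<alpha> b - \<alpha> a - (b - a) *\<^sub>R g (\<alpha> b)) \<le> e * (b - a)"
proof -
  have cont: "continuous_on {s..t} \<alpha>"
    using deriv by (meson continuous_on_eq_continuous_within has_vector_derivative_continuous)
  have "continuous_on {s..t} (\<lambda>\<tau>. g (\<alpha> \<tau>))"
    by (rule continuous_on_compose2[OF cont_g cont]) (use in_ring closure_subset in blast)
  then have "uniformly_continuous_on {s..t} (\<lambda>\<tau>. g (\<alpha> \<tau>))"
    by (intro compact_uniformly_continuous) auto
  then obtain h0 where h0: "h0 > 0"
    "\<And>a b. \<lbrakk>a \<in> {s..t}; b \<in> {s..t}; dist b a < h0\<rbrakk> \<Longrightarrow> dist (g (\<alpha> b)) (g (\<alpha> a)) < e"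
    using \<open>e > 0\<close> unfolding uniformly_continuous_on_def by blast
  show ?thesis
  proof (rule that[OF h0(1)])
    fix a b assume ab: "s \<le> a" "a \<le> b" "b \<le> t" "b - a < h0"
    have "norm (\<alpha> b - \<alpha> a - (b - a) *\<^sub>R g (\<alpha> b)) \<le> norm (b - a) * e"
    proof (rule vector_differentiable_bound_linearization[where S = "{a..b}"])
      fix \<tau> assume \<tau>: "\<tau> \<in> {a..b}"
      show "(\<alpha> has_vector_derivative g (\<alpha> \<tau>)) (at \<tau> within {a..b})"
        using deriv[of \<tau>] \<tau> ab by (auto intro: has_vector_derivative_within_subset[of \<alpha> _ \<tau> "{s..t}"])
      show "norm (g (\<alpha> \<tau>) - g (\<alpha> b)) \<le> e"
        using h0(2)[of b \<tau>] \<tau> ab by (auto simp: dist_norm)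
    qed (use ab in \<open>auto simp: closed_segment_eq_real_ivl\<close>)
    then show "norm (\<alpha> b - \<alpha> a - (b - a) *\<^sub>R g (\<alpha> b)) \<le> e * (b - a)"
      using ab by (simp add: mult.commute)
  qed
qed

lemma streamline_norm_grad_le:
  assumes "s < t" and in_ring: "\<And>\<tau>. \<tau> \<in> {s..t} \<Longrightarrow> \<alpha> \<tau> \<in> \<Omega> - K"
    and deriv: "\<And>\<tau>. \<tau> \<in> {s..t} \<Longrightarrow> (\<alpha> has_vector_derivative g (\<alpha> \<tau>)) (at \<tau> within {s..t})"
  shows "norm (g (\<alpha> s)) \<le> norm (g (\<alpha> t))"
proof (rule field_le_epsilon)
  fix e :: real assume "e > 0"
  have cont: "continuous_on {s..t} \<alpha>"
    using deriv by (meson continuous_on_eq_continuous_within has_vector_derivative_continuous)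
  obtain r0 where r0: "r0 > 0" "(\<Union>x\<in>\<alpha> ` {s..t}. cball x r0) \<subseteq> \<Omega> - K"
    by (rule compact_subset_open_imp_cball_epsilon_subset[of "\<alpha> ` {s..t}" "\<Omega> - K"])
      (use in_ring open_ring compact_continuous_image[OF cont] in auto)
  have tube: "cball (\<alpha> \<tau>) r0 \<subseteq> \<Omega> - K" if "\<tau> \<in> {s..t}" for \<tau>
    using r0(2) that by (simp add: UN_subset_iff)
  have "continuous_on (\<Omega> - K) g"
    by (rule continuous_on_subset[OF cont_g]) (use closure_subset in auto)
  then obtain d where d: "d > 0"
    "\<And>z. \<lbrakk>z \<in> \<Omega> - K; dist z (\<alpha> t) < d\<rbrakk> \<Longrightarrow> dist (g z) (g (\<alpha> t)) < e"
    using in_ring[of t] \<open>s < t\<close> \<open>e > 0\<close> unfolding continuous_on_iff by fastforce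
  \<comment> \<open>The iterates are allowed an error of \<open>r\<close>, and each projection moves
    by at most \<open>2 * r\<close>; both fit into the tube of radius \<open>r0\<close>. Also
    \<open>r < d\<close> controls the gradient at the end.\<close>
  define r where "r = min d r0 / 4"
  have r: "r > 0" "r < d" "4 * r \<le> r0" using d(1) r0(1) by (auto simp: r_def)
  \<comment> \<open>The error per unit time for which the total over \<open>{s..t}\<close> is
    \<open>r\<close>.\<close>
  define \<eta> where "\<eta> = r / (t - s)"
  have \<eta>: "\<eta> > 0" "\<eta> * (t - s) = r" using r \<open>s < t\<close> by (auto simp: \<eta>_def)
  obtain h0 where h0: "h0 > 0" "\<And>a b. \<lbrakk>s \<le> a; a \<le> b; b \<le> t; b - a < h0\<rbrakk> \<Longrightarrow>
      norm (\<alpha> b - \<alpha> a - (b - a) *\<^sub>R g (\<alpha> b)) \<le> \<eta> * (b - a)"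
    using streamline_uniform_euler[OF in_ring deriv \<eta>(1)] by blast
  have "uniformly_continuous_on {s..t} \<alpha>" using cont by (intro compact_uniformly_continuous) auto
  then obtain h1 where h1: "h1 > 0"
    "\<And>a b. \<lbrakk>a \<in> {s..t}; b \<in> {s..t}; dist b a < h1\<rbrakk> \<Longrightarrow> dist (\<alpha> b) (\<alpha> a) < r"
    using r(1) unfolding uniformly_continuous_on_def by blast
  obtain N :: nat where N: "(t - s) / min h0 h1 < real N" using reals_Archimedean2 by blast
  have "0 < (t - s) / min h0 h1" using h0 h1 \<open>s < t\<close> by simp
  then have N0: "N > 0" using N by (cases N) auto
  define h where "h = (t - s) / real N"
  have h: "h > 0" "real N * h = t - s" using N0 \<open>s < t\<close> by (auto simp: h_def)
  have "0 < min h0 h1" using h0 h1 by simp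
  then have "t - s < min h0 h1 * real N"
    using N by (simp only: pos_divide_less_eq mult.commute)
  then have "h < min h0 h1" using N0 by (simp only: h_def pos_divide_less_eq of_nat_0_less_iff)
  then have hh: "h < h0" "h < h1" by auto
  define \<tau> where "\<tau> k = s + real k * h" for k
  have \<tau>in: "\<tau> k \<in> {s..t}" if "k \<le> N" for k
  proof -
    have "real k * h \<le> real N * h" using that h(1) by (intro mult_right_mono) auto
    then show ?thesis using h by (simp add: \<tau>_def)
  qed
  have \<tau>Suc: "\<tau> (Suc k) - \<tau> k = h" for k by (simp add: \<tau>_def algebra_simps)
  define C where "C k = {z. ext (\<alpha> (\<tau> k)) \<le> ext z}" for k
  have C: "closed (C k)" "convex (C k)" "\<alpha> (\<tau> k) \<in> C k" for k
    by (simp_all add: C_def superlevel_closed superlevel_convex)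
  define X where "X = rec_nat (\<alpha> s) (\<lambda>k x. closest_point (C (Suc k)) x)"
  have X0: "X 0 = \<alpha> s" and XSuc: "X (Suc k) = closest_point (C (Suc k)) (X k)" for k
    by (simp_all add: X_def)
  \<comment> \<open>Each step adds at most \<open>\<eta> * h\<close>: projection onto
    \<open>C (Suc k)\<close> is non-expansive, and the projection of
    \<open>\<alpha> (\<tau> k)\<close> misses the next streamline point by at most that
    much.\<close>
  have main: "dist (X k) (\<alpha> (\<tau> k)) \<le> real k * h * \<eta> \<and> norm (g (\<alpha> s)) \<le> norm (g (X k))"
    if "k \<le> N" for k
    using that
  proof (induction k)
    case 0
    then show ?case by (simp add: X0 \<tau>_def)
  next
    case (Suc k)
    define q where "q = \<alpha> (\<tau> (Suc k))"
    have kN: "k \<le> N" using Suc by simp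
    have ih: "dist (X k) (\<alpha> (\<tau> k)) \<le> real k * h * \<eta>" "norm (g (\<alpha> s)) \<le> norm (g (X k))"
      using Suc.IH[OF kN] by auto
    have "real k * h \<le> real N * h" using kN h(1) by (intro mult_right_mono) auto
    then have "real k * h * \<eta> \<le> (t - s) * \<eta>" using \<eta>(1) h(2) by (intro mult_right_mono) auto
    then have er: "dist (X k) (\<alpha> (\<tau> k)) \<le> r" using ih(1) \<eta>(2) by (simp add: mult.commute)
    have "dist (closest_point (C (Suc k)) (X k)) (closest_point (C (Suc k)) (\<alpha> (\<tau> k)))
        \<le> dist (X k) (\<alpha> (\<tau> k))"
      by (rule closest_point_lipschitz) (use C in blast)+
    moreover have "dist (closest_point (C (Suc k)) (\<alpha> (\<tau> k))) q \<le> \<eta> * h"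
      unfolding C_def q_def
    proof (rule dist_closest_point_euler_step[where h = h])
      show "\<alpha> (\<tau> (Suc k)) \<in> \<Omega> - K" using in_ring \<tau>in Suc.prems by blast
      show "norm (\<alpha> (\<tau> (Suc k)) - \<alpha> (\<tau> k) - h *\<^sub>R g (\<alpha> (\<tau> (Suc k)))) \<le> \<eta> * h"
        using h0(2)[of "\<tau> k" "\<tau> (Suc k)"] \<tau>Suc[of k] \<tau>in[OF Suc.prems] \<tau>in[OF kN] h hh by simp
    qed (use h in simp)
    ultimately have "dist (X (Suc k)) q \<le> real k * h * \<eta> + \<eta> * h"
      using ih(1) dist_triangle[of "X (Suc k)" q "closest_point (C (Suc k)) (\<alpha> (\<tau> k))"]
      unfolding XSuc by linarith
    then have 1: "dist (X (Suc k)) q \<le> real (Suc k) * h * \<eta>" by (simp add: algebra_simps)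
    have "dist q (\<alpha> (\<tau> k)) < r"
      unfolding q_def using h1(2)[of "\<tau> k" "\<tau> (Suc k)"] \<tau>in[OF Suc.prems] \<tau>in[OF kN] \<tau>Suc[of k] hh h
      by (simp add: dist_real_def)
    then have Xq: "dist (X k) q \<le> 2 * r"
      using er dist_triangle[of "X k" q "\<alpha> (\<tau> k)"] by (simp add: dist_commute)
    have close: "dist (X k) (X (Suc k)) \<le> dist (X k) z" if "z \<in> C (Suc k)" for z
      unfolding XSuc using C that by (intro closest_point_le) auto
    have dX: "dist (X k) (X (Suc k)) \<le> 2 * r" using close[OF C(3)] Xq by (simp add: q_def)
    have ball: "cball (X k) (dist (X k) (X (Suc k))) \<subseteq> \<Omega> - K"
    proof
      fix z assume "z \<in> cball (X k) (dist (X k) (X (Suc k)))"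
      then have "dist (\<alpha> (\<tau> k)) z \<le> r0"
        using er dX r dist_triangle[of "\<alpha> (\<tau> k)" z "X k"] by (simp add: dist_commute)
      then show "z \<in> \<Omega> - K" using tube[OF \<tau>in[OF kN]] by auto
    qed
    have "norm (g (X k)) \<le> norm (g (X (Suc k)))"
    proof (rule norm_grad_le_closest_point[OF _ ball, where c = "ext q"])
      show "X k \<in> \<Omega> - K" using ball by (rule subsetD) simp
      show "ext q \<le> ext (X (Suc k))"
        using closest_point_in_set[of "C (Suc k)" "X k"] C(1,3)[of "Suc k"]
        unfolding XSuc by (auto simp: C_def q_def)
      show "dist (X k) (X (Suc k)) \<le> dist (X k) z" if "ext q \<le> ext z" for z
        using close that by (simp add: C_def q_def)
    qed
    then show ?case using 1 ih(2) by (simp add: q_def)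
  qed
  have \<tau>N: "\<tau> N = t" using h(2) by (simp add: \<tau>_def)
  have dN: "dist (X N) (\<alpha> t) \<le> r"
    using main[of N] \<eta>(2) h(2) by (simp add: \<tau>N mult.commute)
  have "X N \<in> \<Omega> - K" using tube[of t] dN r \<open>s < t\<close> by (force simp: dist_commute)
  then have "dist (g (X N)) (g (\<alpha> t)) < e" using d(2) dN r by simp
  then have "norm (g (X N)) \<le> norm (g (\<alpha> t)) + e"
    using norm_triangle_ineq2[of "g (X N)" "g (\<alpha> t)"] by (simp add: dist_norm)
  then show "norm (g (\<alpha> s)) \<le> norm (g (\<alpha> t)) + e" using main[of N] by simp
qed

text \<open>Differentiability up to the outer boundary: near \<open>x\<close>, subtracting the
  linear part leaves a function with gradient below \<open>e\<close> on a convex subset of \<Omega>.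
  Its Lipschitz bound passes to the closure.\<close>

lemma has_derivative_ext_closure:
  assumes x: "x \<in> closure \<Omega> - K"
  shows "(ext has_derivative (\<lambda>h. h \<bullet> g x)) (at x within closure \<Omega>)"
  unfolding has_derivative_within_alt
proof (intro conjI allI impI)
  show "bounded_linear (\<lambda>h. h \<bullet> g x)" by (rule bounded_linear_inner_left)
  fix e :: real assume "e > 0"
  have "open (- K)" using K by (simp add: compact_imp_closed open_Compl)
  then obtain d1 where d1: "d1 > 0" "ball x d1 \<subseteq> - K" using x open_contains_ball by blast
  obtain d2 where d2: "d2 > 0"
    "\<And>z. \<lbrakk>z \<in> closure \<Omega> - K; dist z x < d2\<rbrakk> \<Longrightarrow> dist (g z) (g x) < e"
    using cont_g x \<open>e > 0\<close> unfolding continuous_on_iff by fastforce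
  define d where "d = min d1 d2"
  have d: "d > 0" using d1 d2 by (simp add: d_def)
  define S where "S = ball x d \<inter> \<Omega>"
  have S: "z \<in> \<Omega> - K" "dist z x < d2" if "z \<in> S" for z
    using that d1(2) by (auto simp: S_def d_def dist_commute subset_iff)
  have "convex S" unfolding S_def using \<Omega> by (intro convex_Int) auto
  have "e-lipschitz_on S (\<lambda>z. ext z - z \<bullet> g x)"
  proof (rule lipschitz_onI)
    fix a b assume ab: "a \<in> S" "b \<in> S"
    have "norm ((ext a - a \<bullet> g x) - (ext b - b \<bullet> g x)) \<le> e * norm (a - b)"
    proof (rule differentiable_bound[OF \<open>convex S\<close> _ _ ab, where f' = "\<lambda>z h. h \<bullet> (g z - g x)"])
      fix z assume z: "z \<in> S"
      show "((\<lambda>z. ext z - z \<bullet> g x) has_derivative (\<lambda>h. h \<bullet> (g z - g x))) (at z within S)"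
        using has_derivative_at_withinI[OF has_derivative_ext[OF S(1)[OF z]], of S]
        by (auto intro!: derivative_eq_intros simp: inner_diff_right)
      have "dist (g z) (g x) < e" using S[OF z] d2(2)[of z] closure_subset by blast
      then have "norm (h \<bullet> (g z - g x)) \<le> e * norm h" for h
        using Cauchy_Schwarz_ineq2[of h "g z - g x"] mult_left_mono[of "norm (g z - g x)" e "norm h"]
        by (simp add: dist_norm mult.commute)
      then show "onorm (\<lambda>h. h \<bullet> (g z - g x)) \<le> e" by (intro onorm_le)
    qed
    then show "dist (ext a - a \<bullet> g x) (ext b - b \<bullet> g x) \<le> e * dist a b" by (simp add: dist_norm)
  qed (use \<open>e > 0\<close> in simp)
  then have lip: "e-lipschitz_on (closure S) (\<lambda>z. ext z - z \<bullet> g x)"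
    by (rule lipschitz_on_closure)
      (intro continuous_intros continuous_on_subset[OF continuous_ext] subset_UNIV)
  have cl: "z \<in> closure S" if "z \<in> closure \<Omega>" "dist x z < d" for z
    using open_Int_closure_subset[of "ball x d" \<Omega>] that by (auto simp: S_def)
  show "\<exists>d>0. \<forall>y\<in>closure \<Omega>. norm (y - x) < d \<longrightarrow>
      norm (ext y - ext x - (y - x) \<bullet> g x) \<le> e * norm (y - x)"
  proof (intro exI[of _ d] conjI ballI impI d)
    fix y assume y: "y \<in> closure \<Omega>" "norm (y - x) < d"
    then have "dist (ext y - y \<bullet> g x) (ext x - x \<bullet> g x) \<le> e * dist y x"
      using x d by (intro lipschitz_onD[OF lip] cl) (auto simp: dist_norm norm_minus_commute)
    then show "norm (ext y - ext x - (y - x) \<bullet> g x) \<le> e * norm (y - x)"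
      by (simp add: dist_norm inner_diff_left algebra_simps)
  qed
qed

lemma streamline_ext_derivative:
  assumes "\<And>t. t \<in> I \<Longrightarrow> \<alpha> t \<in> closure \<Omega> - K" "t \<in> I"
    and "(\<alpha> has_vector_derivative g (\<alpha> t)) (at t within I)"
  shows "((\<lambda>t. ext (\<alpha> t)) has_real_derivative (norm (g (\<alpha> t)))\<^sup>2) (at t within I)"
proof -
  have "(ext has_derivative (\<lambda>h. h \<bullet> g (\<alpha> t))) (at (\<alpha> t) within \<alpha> ` I)"
    by (rule has_derivative_subset[OF has_derivative_ext_closure]) (use assms in auto)
  then have "((ext \<circ> \<alpha>) has_vector_derivative (g (\<alpha> t) \<bullet> g (\<alpha> t))) (at t within I)"
    by (rule vector_derivative_diff_chain_within[OF assms(3)])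
  then show ?thesis
    by (simp add: has_real_derivative_iff_has_vector_derivative power2_norm_eq_inner o_def)
qed

lemma streamline_norm_grad_mono:
  assumes "0 < T" and cont: "continuous_on {0..T} \<alpha>"
    and in_ring: "\<And>t. t \<in> {0..<T} \<Longrightarrow> \<alpha> t \<in> closure \<Omega> - K"
    and deriv: "\<And>t. t \<in> {0..<T} \<Longrightarrow> (\<alpha> has_vector_derivative g (\<alpha> t)) (at t within {0..<T})"
    and start: "\<alpha> 0 \<in> frontier \<Omega>"
  shows "mono_on {0..<T} (\<lambda>t. norm (g (\<alpha> t)))"
proof (rule mono_onI)
  have front: "x \<notin> \<Omega>" if "x \<in> frontier \<Omega>" for x
    using that \<Omega>(1) by (simp add: frontier_def interior_open)
  have w': "((\<lambda>t. ext (\<alpha> t)) has_real_derivative (norm (g (\<alpha> t)))\<^sup>2) (at t within {0..<T})"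
    if "t \<in> {0..<T}" for t
    using in_ring deriv that by (intro streamline_ext_derivative) auto
  have contw: "continuous_on {0..<T} (\<lambda>t. ext (\<alpha> t))"
    by (rule DERIV_continuous_on) (rule w')
  \<comment> \<open>A streamline that is on the outer boundary at a positive time has not moved before that time.\<close>
  have zero: "g (\<alpha> s) = 0" if b: "b \<in> {0..<T}" "\<alpha> b \<notin> \<Omega>" "0 < b" and s: "s \<in> {0..b}" for b s
  proof -
    have mono: "ext (\<alpha> x) \<le> ext (\<alpha> y)" if "0 \<le> x" "x \<le> y" "y < T" for x y
    proof (rule DERIV_nonneg_imp_increasing_open[OF that(2)])
      show "\<exists>l. ((\<lambda>t. ext (\<alpha> t)) has_real_derivative l) (at z) \<and> 0 \<le> l" if "x < z" "z < y" for z
      proof (intro exI conjI)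
        have "z \<in> interior {0..<T}" using that \<open>0 \<le> x\<close> \<open>y < T\<close> by simp
        then show "((\<lambda>t. ext (\<alpha> t)) has_real_derivative (norm (g (\<alpha> z)))\<^sup>2) (at z)"
          using w'[of z] interior_subset by (metis at_within_interior subsetD)
      qed simp
      show "continuous_on {x..y} (\<lambda>t. ext (\<alpha> t))"
        by (rule continuous_on_subset[OF contw]) (use that in auto)
    qed
    \<comment> \<open>Monotonicity squeezes these values between 0 and the value at time
      \<open>b\<close>, which is 0 outside \<Omega>.\<close>
    have const: "ext (\<alpha> x) = 0" if "x \<in> {0..b}" for x
      using mono[of 0 x] mono[of x b] that b ext_outside[OF b(2)] ext_bounds(1)[of "\<alpha> x"] by simp
    have "((\<lambda>t. ext (\<alpha> t)) has_real_derivative (norm (g (\<alpha> s)))\<^sup>2) (at s within {0..b})"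
      by (rule DERIV_subset[OF w']) (use b s in auto)
    moreover have "((\<lambda>t. ext (\<alpha> t)) has_real_derivative 0) (at s within {0..b})"
      by (rule has_field_derivative_transform_within[of "\<lambda>_. 0" _ _ _ 1])
        (use const s in auto)
    moreover have "at s within {0..b} \<noteq> bot"
      using s b by (simp add: trivial_limit_within islimpt_Icc)
    ultimately have "(norm (g (\<alpha> s)))\<^sup>2 = 0"
      using has_field_derivative_unique by blast
    then show ?thesis by simp
  qed
  fix s t assume s: "s \<in> {0..<T}" and t: "t \<in> {0..<T}" and "s \<le> t"
  show "norm (g (\<alpha> s)) \<le> norm (g (\<alpha> t))"
  proof (cases "s = t \<or> (\<exists>b\<in>{s<..t}. \<alpha> b \<notin> \<Omega>)")
    case True
    then show ?thesis
    proof
      assume "\<exists>b\<in>{s<..t}. \<alpha> b \<notin> \<Omega>"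
      then obtain b where "s < b" "b \<le> t" "\<alpha> b \<notin> \<Omega>" by auto
      then show ?thesis using zero[of b s] s t by simp
    qed simp
  next
    case False
    then have inside: "\<alpha> b \<in> \<Omega> - K" if "b \<in> {s<..t}" for b
      using \<open>s \<le> t\<close> in_ring[of b] that s t by auto
    have st: "s < t" using False \<open>s \<le> t\<close> by auto
    \<comment> \<open>The time \<open>s\<close> itself may be spent on the outer boundary, so the
      interior result starts at a later \<open>x\<close>, and continuity lets \<open>x\<close> tend
      to \<open>s\<close>.\<close>
    have le: "norm (g (\<alpha> x)) \<le> norm (g (\<alpha> t))" if "x \<in> {s<..<t}" for x
    proof (rule streamline_norm_grad_le)
      show "(\<alpha> has_vector_derivative g (\<alpha> y)) (at y within {x..t})" if "y \<in> {x..t}" for y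
        using deriv[of y] that \<open>x \<in> _\<close> s t
        by (auto intro: has_vector_derivative_within_subset[of \<alpha> _ y "{0..<T}"])
    qed (use that inside in auto)
    have contg: "continuous_on {s..t} (\<lambda>x. norm (g (\<alpha> x)))"
      by (intro continuous_on_norm continuous_on_compose2[OF cont_g] continuous_on_subset[OF cont])
        (use in_ring s t in auto)
    show ?thesis
    proof (rule continuous_le_on_closure[of "{s<..<t}" "\<lambda>x. norm (g (\<alpha> x))" s])
    qed (use contg le st in auto)
  qed
qed

end

theorem theorem1:
  fixes \<Omega> K G :: "(real^2) set"
    and u :: "real^2 \<Rightarrow> real"
    and grad_u :: "real^2 \<Rightarrow> real^2"
    and \<alpha> :: "real \<Rightarrow> real^2"
    and T :: real
  assumes "open \<Omega>" and "bounded \<Omega>" and "convex \<Omega>"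
    and "compact K" and "convex K" and "K \<noteq> {}" and "K \<subseteq> \<Omega>"
    and "G = \<Omega> - K"
    and "continuous_on (closure G) u"
    and "inf_harmonic_viscosity G u"
    and "\<forall>x\<in>frontier \<Omega>. u x = 0"
    and "\<forall>x\<in>frontier K. u x = 1"
    and "\<forall>x\<in>G. GDERIV u x :> grad_u x"
    and "continuous_on (closure \<Omega> - K) grad_u"
    and "0 < T"
    and "continuous_on {0..T} \<alpha>"
    and "\<forall>t\<in>{0..<T}. \<alpha> t \<in> closure \<Omega> - K"
    and "\<forall>t\<in>{0..<T}. (\<alpha> has_vector_derivative grad_u (\<alpha> t)) (at t within {0..<T})"
    and "\<alpha> 0 \<in> frontier \<Omega>"
    and "\<alpha> T \<in> frontier K"
  shows "convex_on {0..T} (\<lambda>t. u (\<alpha> t)) \<and>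
         mono_on {0..<T} (\<lambda>t. norm (grad_u (\<alpha> t)))"
proof -
  interpret smooth_convex_ring_potential \<Omega> K u grad_u
    by unfold_locales (use assms in auto)
  have mono: "mono_on {0..<T} (\<lambda>t. norm (grad_u (\<alpha> t)))"
    using assms by (intro streamline_norm_grad_mono) auto
  have "x \<in> closure (\<Omega> - K)" if "x \<in> closure \<Omega> - K" for x
    using that open_Int_closure_subset[of "- K" \<Omega>] K
    by (auto simp: compact_imp_closed open_Compl Diff_eq Int_commute)
  \<comment> \<open>Points of \<Omega> near this boundary point of \<open>K\<close> include points
    outside \<open>K\<close>; this puts the endpoint \<open>\<alpha> T\<close> in the domain of
    continuity of \<open>u\<close>.\<close>
  moreover have "x \<in> closure (\<Omega> - K)" if "x \<in> frontier K" for x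
  proof -
    have "x \<in> \<Omega> \<inter> closure (- K)"
      using that frontier_subset_closed[of K] K by (auto simp: compact_imp_closed frontier_closures)
    then show ?thesis using open_Int_closure_subset[OF \<Omega>(1), of "- K"] by (auto simp: Diff_eq)
  qed
  ultimately have in_closure: "\<alpha> t \<in> closure (\<Omega> - K)" if "t \<in> {0..T}" for t
    using assms that by (cases "t = T") auto
  have "convex_on {0..T} (\<lambda>t. u (\<alpha> t))"
  proof (rule convex_on_mono_derivative)
    show "continuous_on {0..T} (\<lambda>t. u (\<alpha> t))"
      by (rule continuous_on_compose2[OF cont_u]) (use assms in_closure in auto)
    fix x assume x: "0 < x" "x < T"
    have "((\<lambda>t. ext (\<alpha> t)) has_real_derivative (norm (grad_u (\<alpha> x)))\<^sup>2) (at x within {0..<T})"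
      by (rule streamline_ext_derivative) (use assms x in auto)
    then have "((\<lambda>t. ext (\<alpha> t)) has_real_derivative (norm (grad_u (\<alpha> x)))\<^sup>2) (at x)"
      using at_within_interior[of x "{0..<T}"] x by simp
    \<comment> \<open>Along the streamline \<open>u\<close> and \<open>ext\<close> agree on the
      whole open time interval, so the derivative transfers.\<close>
    then show "((\<lambda>t. u (\<alpha> t)) has_real_derivative (norm (grad_u (\<alpha> x)))\<^sup>2) (at x)"
      by (rule DERIV_cong_ev[THEN iffD1, OF refl _ refl, rotated])
        (use x in \<open>auto simp: ext_eq in_closure intro!: eventually_nhds_in_open[of "{0<..<T}", THEN eventually_mono]\<close>)
  next
    fix x y assume "0 < x" "x \<le> y" "y < T"
    then show "(norm (grad_u (\<alpha> x)))\<^sup>2 \<le> (norm (grad_u (\<alpha> y)))\<^sup>2"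
      by (intro power_mono mono_onD[OF mono]) auto
  qed
  with mono show ?thesis by simp
qed

end
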